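(* Let $(X_i,\mathcal{F}_i)_{i\ge 0}$ be a supermartingale difference sequence with $X_0=0$ and $\mathbb{P}(X_i\le 1)=1$ for all $i$. Let $\sigma_i^2:=\mathbb{E}[X_i^2\mid\mathcal{F}_{i-1}]$ for $i\ge1$. Let $x\ge 0$ and $0<v<\infty$, and for $k\ge 1$ let \[ \mathcal{E}_k:=\left\{\sum_{i=1}^k X_i\ge x\ \text{ and }\ \sum_{i=1}^k\sigma_i^2\le v^2\right\}. \] Then for every $n\ge 1$, \[ \mathbb{P}\left(\bigcup_{k=1}^n\mathcal{E}_k\right)\le \inf_{\lambda\ge 0}\mathbb{E}\left[\left(1+\frac{\lambda}{2}\left(\sum_{i=1}^n G_i-x\right)\right)_+^2\right]\le \inf_{\lambda\ge 0}\mathbb{E}\left[\left(1+\frac{\lambda}{2}\left(\widetilde{\Pi}_{v^2}-x\right)\right)_+^2\right], \] where $G_1,\dots,G_n$ are independent and identically distributed with \[ \mathbb{P}(G_i=-v^2/n)=\frac{1}{1+v^2/n},\qquad \mathbb{P}(G_i=1)=\frac{v^2/n}{1+v^2/n}, \] and $\widetilde{\Pi}_{v^2}$ is distributed as $N-v^2$ with $N\sim\mathrm{Poisson}(v^2)$. In particular, \[ \mathbb{P}\left(\sum_{i=1}^n X_i\ge x\ \text{ and }\ \sum_{i=1}^n\sigma_i^2\le v^2\ \text{ for some } n\ge 1\right)\le \inf_{\lambda\ge 0}\mathbb{E}\left[\left(1+\frac{\lambda}{2}\left(\widetilde{\Pi}_{v^2}-x\right)\right)_+^2\right]\le \frac{e^2}{2}\,\mathbb{P}^{\circ}(\widetilde{\Pi}_{v^2}\ge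 x), \] where $x\mapsto \mathbb{P}^{\circ}(\widetilde{\Pi}_{v^2}\ge x)$ is the least log-concave majorant of the function $x\mapsto\mathbb{P}(\widetilde{\Pi}_{v^2}\ge x)$ on $\mathbb{R}$.
   Context: A supermartingale difference sequence $(X_i,\mathcal{F}_i)_{i\ge0}$ consists of a filtration $(\mathcal{F}_i)_{i\ge 0}$ and integrable real random variables $X_i$ such that $X_i$ is $\mathcal{F}_i$-measurable and $\mathbb{E}[X_i\mid\mathcal{F}_{i-1}]\le 0$ almost surely for $i\ge 1$. Notation: $u_+=\max\{u,0\}$ and $u_+^{\alpha}=(u_+)^{\alpha}$. The least log-concave majorant of a function $f:\mathbb{R}\to[0,\infty)$ is the smallest log-concave function $f^\circ$ with $f^\circ\ge f$ pointwise. *)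

theory Defs
  imports "HOL-Probability.Probability"
begin

text \<open>The inequality for the conditional expectation is required for i \<open>\<ge>\<close> 1 only:
  nothing but integrability and measurability is asked of X 0.\<close>

definition supermartingale_difference ::
  "'a measure \<Rightarrow> (nat \<Rightarrow> 'a measure) \<Rightarrow> (nat \<Rightarrow> 'a \<Rightarrow> real) \<Rightarrow> bool" where
  "supermartingale_difference M F X \<longleftrightarrow>
     filtration (space M) F \<and> (\<forall>i. subalgebra M (F i)) \<and>
     (\<forall>i. X i \<in> borel_measurable (F i)) \<and> (\<forall>i. integrable M (X i)) \<and>
     (\<forall>i\<ge>1. AE \<omega> in M. real_cond_exp M (F (i - 1)) (X i) \<omega> \<le> 0)"

text \<open>Square-integrability is not assumed, so the conditional second moment is taken in
  \<open>[0, \<infinity>]\<close>; \<open>real_cond_exp\<close> would send infinite values to 0.\<close>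

definition cond_second_moment ::
  "'a measure \<Rightarrow> (nat \<Rightarrow> 'a measure) \<Rightarrow> (nat \<Rightarrow> 'a \<Rightarrow> real) \<Rightarrow> nat \<Rightarrow> 'a \<Rightarrow> ennreal" where
  "cond_second_moment M F X i = nn_cond_exp M (F (i - 1)) (\<lambda>\<omega>. ennreal ((X i \<omega>)\<^sup>2))"

definition tail_event ::
  "'a measure \<Rightarrow> (nat \<Rightarrow> 'a measure) \<Rightarrow> (nat \<Rightarrow> 'a \<Rightarrow> real) \<Rightarrow> real \<Rightarrow> real \<Rightarrow> nat \<Rightarrow> 'a set" where
  "tail_event M F X x v k =
     {\<omega> \<in> space M. (\<Sum>i=1..k. X i \<omega>) \<ge> x \<and>
        (\<Sum>i=1..k. cond_second_moment M F X i \<omega>) \<le> ennreal (v\<^sup>2)}"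

definition two_point_iid ::
  "'b measure \<Rightarrow> nat \<Rightarrow> (nat \<Rightarrow> 'b \<Rightarrow> real) \<Rightarrow> real \<Rightarrow> bool" where
  "two_point_iid P n G s \<longleftrightarrow>
     prob_space.indep_vars P (\<lambda>_. borel) G {1..n} \<and>
     (\<forall>i\<in>{1..n}. measure P {\<omega> \<in> space P. G i \<omega> = - s} = 1 / (1 + s) \<and>
                 measure P {\<omega> \<in> space P. G i \<omega> = 1} = s / (1 + s))"

definition quadratic_tail_bound :: "'b measure \<Rightarrow> ('b \<Rightarrow> real) \<Rightarrow> real \<Rightarrow> real" where
  "quadratic_tail_bound P Y x =
     (INF l\<in>{0..}. \<integral>\<omega>. (max 0 (1 + l / 2 * (Y \<omega> - x)))\<^sup>2 \<partial>P)"

text \<open>Since \<open>0 powr a = 0\<close>, the inequality is void where one of the two values is 0.\<close>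

definition log_concave_fun :: "(real \<Rightarrow> real) \<Rightarrow> bool" where
  "log_concave_fun f \<longleftrightarrow> (\<forall>x. 0 \<le> f x) \<and>
     (\<forall>x y. \<forall>t\<in>{0<..<1}. f x powr (1 - t) * f y powr t \<le> f ((1 - t) * x + t * y))"

definition log_concave_majorant :: "(real \<Rightarrow> real) \<Rightarrow> real \<Rightarrow> real" where
  "log_concave_majorant f = (LEAST g. log_concave_fun g \<and> f \<le> g)"

lemma log_concave_majorant_least:
  fixes f :: "real \<Rightarrow> real"
  assumes nonneg: "\<And>x. 0 \<le> f x" and bounded: "\<And>x. f x \<le> B"
  shows "log_concave_fun (log_concave_majorant f)"
    and "f \<le> log_concave_majorant f"
    and "\<And>g. log_concave_fun g \<Longrightarrow> f \<le> g \<Longrightarrow> log_concave_majorant f \<le> g"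
proof -
  define H where "H = {h. log_concave_fun h \<and> f \<le> h}"
  define g where "g x = (INF h\<in>H. h x)" for x
  have B0: "0 \<le> B"
    using nonneg[of 0] bounded[of 0] by linarith
  have "log_concave_fun (\<lambda>_. B)"
    using B0 by (cases "B = 0") (auto simp: log_concave_fun_def simp flip: powr_add)
  then have ne: "H \<noteq> {}"
    using bounded by (auto simp: H_def le_fun_def)
  have bdd: "bdd_below ((\<lambda>h. h x) ` H)" for x
    by (rule bdd_belowI[of _ 0]) (auto simp: H_def log_concave_fun_def)
  have lower: "g x \<le> h x" if "h \<in> H" for h x
    unfolding g_def by (rule cINF_lower[OF bdd that])
  have g0: "0 \<le> g x" for x
    unfolding g_def using ne by (intro cINF_greatest) (auto simp: H_def log_concave_fun_def)
  have "g x powr (1 - t) * g y powr t \<le> g ((1 - t) * x + t * y)" if t: "t \<in> {0<..<1}" for x y t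
  proof -
    have "g x powr (1 - t) * g y powr t \<le> h ((1 - t) * x + t * y)" if h: "h \<in> H" for h
    proof -
      have "g x powr (1 - t) * g y powr t \<le> h x powr (1 - t) * h y powr t"
        using t g0 lower[OF h] by (intro mult_mono powr_mono2) auto
      also have "\<dots> \<le> h ((1 - t) * x + t * y)"
        using h t by (auto simp: H_def log_concave_fun_def)
      finally show ?thesis .
    qed
    then show ?thesis
      unfolding g_def[of "(1 - t) * x + t * y"] using ne by (intro cINF_greatest) auto
  qed
  then have lc: "log_concave_fun g"
    using g0 by (auto simp: log_concave_fun_def)
  have fg: "f \<le> g"
    unfolding le_fun_def g_def using ne by (intro allI cINF_greatest) (auto simp: H_def le_fun_def)
  have least: "g \<le> h" if "log_concave_fun h" "f \<le> h" for h
    using lower[of h] that by (auto simp: H_def le_fun_def)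
  have eq: "log_concave_majorant f = g"
    unfolding log_concave_majorant_def by (rule Least_equality) (use lc fg least in auto)
  show "log_concave_fun (log_concave_majorant f)" "f \<le> log_concave_majorant f"
    "\<And>h. log_concave_fun h \<Longrightarrow> f \<le> h \<Longrightarrow> log_concave_majorant f \<le> h"
    unfolding eq using lc fg least by auto
qed

end

theory Submission
  imports Defs
begin

text \<open>
Write \<open>f u = (max 0 u)\<^sup>2\<close> and let \<open>T s g y\<close> be the expectation of \<open>g (y + \<eta>)\<close>, where \<open>\<eta>\<close> has mean zero,
variance \<open>s\<close> and values in \<open>{- s, 1}\<close>. A quadratic that majorizes \<open>f\<close> on the half-line and meets it
at both atoms gives \<open>E f (y + X) \<le> T s f y\<close> whenever \<open>X \<le> 1\<close>, \<open>E X \<le> 0\<close> and \<open>E X\<^sup>2 \<le> s\<close>; this survives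
composition with further operators \<open>T c\<close>. Splitting a variance budget evenly is optimal,
\<open>T s (T c\<^sup>k f) \<le> T m\<^sup>k\<^sup>+\<^sup>1 f\<close> with \<open>m\<close> the mean of the parameters. Hence, with \<open>V k\<close> the accumulated conditional
variance and \<open>r = (v\<^sup>2 - V k) / (n - k)\<close>, the process \<open>T r\<^sup>n\<^sup>-\<^sup>k f (h - x + S k)\<close>, killed
once \<open>V k > v\<^sup>2\<close>, is a nonnegative supermartingale that is at least \<open>h\<^sup>2\<close> on the \<open>k\<close>-th event; the maximal
inequality with \<open>h = 2 / \<lambda>\<close> is the first bound. A quadratic minorant coming from Cauchy--Schwarz shows
that one two-point variable is dominated by a centred Poisson variable of the same variance, which
convolves to the second bound. For the last one, the log-concave majorant lies below the exponential
given by a supporting line of its logarithm at \<open>x\<close>; integrating that exponential tail with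
\<open>\<lambda>\<close> equal to its rate gives the constant \<open>e\<^sup>2 / 2\<close>.
\<close>

section \<open>The two-point operator\<close>

definition pos_sq :: "real \<Rightarrow> real" where
  "pos_sq u = (max 0 u)\<^sup>2"

definition two_point_op :: "real \<Rightarrow> (real \<Rightarrow> real) \<Rightarrow> real \<Rightarrow> real" where
  "two_point_op s g y = (g (y - s) + s * g (y + 1)) / (1 + s)"

lemma pos_sq_nonneg: "0 \<le> pos_sq u"
  by (simp add: pos_sq_def)

lemma pos_sq_mono: "u \<le> w \<Longrightarrow> pos_sq u \<le> pos_sq w"
  by (auto simp: pos_sq_def intro: power_mono)

lemma measurable_pos_sq [measurable]: "pos_sq \<in> borel_measurable borel"
  unfolding pos_sq_def by measurable

lemma pos_sq_mult: "0 \<le> a \<Longrightarrow> pos_sq (a * b) = a\<^sup>2 * pos_sq b"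
  by (cases "0 \<le> b") (simp_all add: pos_sq_def power_mult_distrib mult_nonneg_nonpos)

lemma pos_sq_eq: "0 \<le> u \<Longrightarrow> pos_sq u = u\<^sup>2" "u \<le> 0 \<Longrightarrow> pos_sq u = 0"
  by (auto simp: pos_sq_def max_def)

lemma pos_sq_le_square: "pos_sq u \<le> u\<^sup>2"
  by (auto simp: pos_sq_def max_def)

lemma two_point_op_0 [simp]: "two_point_op 0 g = g"
  by (auto simp: two_point_op_def)

lemma two_point_op_mono:
  assumes "0 \<le> s" "\<And>z. g z \<le> h z"
  shows "two_point_op s g y \<le> two_point_op s h y"
  unfolding two_point_op_def using assms
  by (intro divide_right_mono add_mono mult_left_mono) auto

lemma two_point_op_funpow_mono:
  assumes "0 \<le> s" "\<And>z. g z \<le> h z"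
  shows "(two_point_op s ^^ k) g y \<le> (two_point_op s ^^ k) h y"
  by (induction k arbitrary: y) (auto intro: two_point_op_mono assms)

text \<open>Both sides are the expectation of \<open>g\<close> at \<open>y\<close> plus two
  independent two-point variables, a sum that does not depend on the order.\<close>

lemma two_point_op_commute:
  "two_point_op s (two_point_op c g) = two_point_op c (two_point_op s g)"
proof
  fix y
  have *: "((a + c * b) / (1 + c) + s * ((d + c * e) / (1 + c))) / (1 + s) =
      (a + c * b + s * d + s * c * e) / ((1 + s) * (1 + c))" for a b d e s c :: real
    by (simp add: algebra_simps flip: add_divide_distrib)
  have "y - s - c = y - c - s" "y - s + 1 = y + 1 - s" "y - c + 1 = y + 1 - c"
    by auto
  then show "two_point_op s (two_point_op c g) y = two_point_op c (two_point_op s g) y"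
    unfolding two_point_op_def * by (simp add: algebra_simps)
qed

lemma two_point_op_funpow_commute:
  "two_point_op s ((two_point_op c ^^ k) g) = (two_point_op c ^^ k) (two_point_op s g)"
  by (induction k) (auto simp: two_point_op_commute[of s])

lemma two_point_op_funpow_shift:
  "(two_point_op s ^^ k) (\<lambda>z. g (z + u)) y = (two_point_op s ^^ k) g (y + u)"
  by (induction k arbitrary: y) (auto simp: two_point_op_def algebra_simps)

lemma two_point_op_funpow_linear:
  "(two_point_op s ^^ k) (\<lambda>z. f z + g z * a + h z * b) y =
     (two_point_op s ^^ k) f y + (two_point_op s ^^ k) g y * a + (two_point_op s ^^ k) h y * b"
  by (induction k arbitrary: y)
    (auto simp: two_point_op_def add_divide_distrib algebra_simps)

lemma two_point_op_funpow_nonneg: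
  assumes "0 \<le> s" "\<And>z. 0 \<le> g z"
  shows "0 \<le> (two_point_op s ^^ k) g y"
  using assms by (induction k arbitrary: y) (auto simp: two_point_op_def)

text \<open>Each application moves the argument up by at most 1, so \<open>k\<close> of them see
  only points up to \<open>y + real k\<close>. The bound does not involve \<open>s\<close>, which
  later yields integrability with random parameters.\<close>

lemma two_point_op_funpow_le:
  assumes "0 \<le> s" "\<And>z. z \<le> y + real k \<Longrightarrow> g z \<le> C"
  shows "(two_point_op s ^^ k) g y \<le> C"
  using assms(2)
proof (induction k arbitrary: y)
  case (Suc k)
  have "(two_point_op s ^^ k) g (y - s) \<le> C" "(two_point_op s ^^ k) g (y + 1) \<le> C"
    using assms(1) by (auto intro!: Suc.IH Suc.prems)
  then have "(two_point_op s ^^ k) g (y - s) + s * (two_point_op s ^^ k) g (y + 1) \<le> C + s * C"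
    using assms(1) by (intro add_mono mult_left_mono)
  then show ?case
    using assms(1) by (simp add: two_point_op_def[of _ "(_ ^^ _) _"] field_simps)
qed auto

text \<open>Joint continuity in the parameter and the argument; it carries an iterated averaging of
  parameters to its limit.\<close>

lemma tendsto_two_point_op_funpow:
  assumes "0 \<le> c0" "(c \<longlongrightarrow> c0) F" "(y \<longlongrightarrow> y0) F" "\<And>z. isCont g z"
  shows "((\<lambda>n. (two_point_op (c n) ^^ k) g (y n)) \<longlongrightarrow> (two_point_op c0 ^^ k) g y0) F"
  using assms(3)
proof (induction k arbitrary: y y0)
  case 0
  then show ?case
    using isCont_tendsto_compose[OF assms(4)] by simp
next
  case (Suc k)
  show ?case
    unfolding funpow.simps comp_def two_point_op_def[of _ "(_ ^^ _) _"]
    using assms(1) by (intro tendsto_intros Suc assms(2)) auto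
qed

text \<open>Parameter, function and argument may all be random. Measurability of \<open>g\<close> is
  asked only along measurable arguments, so the lemma can be applied again to its own conclusion
  when operators are nested.\<close>

lemma measurable_two_point_op_funpow:
  fixes g :: "'a \<Rightarrow> real \<Rightarrow> real"
  assumes "c \<in> borel_measurable M" "y \<in> borel_measurable M"
    and "\<And>z. z \<in> borel_measurable M \<Longrightarrow> (\<lambda>\<omega>. g \<omega> (z \<omega>)) \<in> borel_measurable M"
  shows "(\<lambda>\<omega>. (two_point_op (c \<omega>) ^^ k) (g \<omega>) (y \<omega>)) \<in> borel_measurable M"
  using assms(2)
proof (induction k arbitrary: y)
  case 0
  then show ?case using assms(3) by simp
next
  case (Suc k)
  show ?case
    unfolding funpow.simps comp_def two_point_op_def[of _ "(_ ^^ _) _"]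
    by (intro borel_measurable_divide borel_measurable_add borel_measurable_times Suc.IH
        borel_measurable_diff assms(1) Suc.prems borel_measurable_const)
qed

section \<open>Closed form, monotonicity in the variance, and even splitting of a variance
  budget\<close>

lemma two_point_op_pos_sq:
  "two_point_op s pos_sq y = (if s \<le> y then y\<^sup>2 + s else s * pos_sq (y + 1) / (1 + s))" if "0 \<le> s"
\<comment> \<open>If \<open>s \<le> y\<close>, both atoms lie where \<open>pos_sq\<close> is the
  square, and the value is squared mean plus variance. Otherwise the lower atom \<open>y - s\<close>
  is negative and only the upper one contributes.\<close>
proof (cases "s \<le> y")
  case True
  then show ?thesis
    using that by (simp add: two_point_op_def pos_sq_eq field_simps power2_eq_square)
next
  case False
  then show ?thesis
    using that by (simp add: two_point_op_def pos_sq_eq)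
qed

text \<open>Each branch of the closed form increases with the variance; only
  \<open>s \<le> y < r\<close>, where the two sides use different branches, needs an
  argument.\<close>

lemma two_point_op_pos_sq_mono:
  assumes "0 \<le> s" "s \<le> r"
  shows "two_point_op s pos_sq y \<le> two_point_op r pos_sq y"
proof -
  consider "r \<le> y" | "y < s" | "s \<le> y" "y < r" by linarith
  then show ?thesis
  proof cases
    case 2
    have "s / (1 + s) \<le> r / (1 + r)"
      using assms by (simp add: field_simps)
    then have "s / (1 + s) * pos_sq (y + 1) \<le> r / (1 + r) * pos_sq (y + 1)"
      by (intro mult_right_mono pos_sq_nonneg)
    then show ?thesis
      using 2 assms by (simp add: two_point_op_pos_sq)
  next
    case 3
    have "(y\<^sup>2 + s) * (1 + r) \<le> r * (y + 1)\<^sup>2"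
    proof -
      \<comment> \<open>This sum is the right side minus the left side of the goal, grouped so that
        both terms are visibly nonnegative.\<close>
      have "0 \<le> (r - y) * (y + 1) + (y - s) * (1 + r)" using 3 assms by (intro add_nonneg_nonneg mult_nonneg_nonneg) auto
      then show ?thesis by (simp add: power2_eq_square algebra_simps)
    qed
    then show ?thesis
      using 3 assms by (simp add: two_point_op_pos_sq pos_sq_eq field_simps)
  qed (use assms in \<open>auto simp: two_point_op_pos_sq\<close>)
qed

text \<open>This is Jensen's inequality for a mean-zero perturbation, read off from monotonicity in
  the variance starting at parameter 0.\<close>

lemma pos_sq_le_two_point_op_funpow:
  assumes "0 \<le> s"
  shows "pos_sq y \<le> (two_point_op s ^^ k) pos_sq y"
proof (induction k arbitrary: y)
  case (Suc k)
  have "pos_sq y \<le> two_point_op s pos_sq y"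
    using two_point_op_pos_sq_mono[of 0 s y] assms by simp
  also have "\<dots> \<le> two_point_op s ((two_point_op s ^^ k) pos_sq) y"
    by (intro two_point_op_mono assms Suc)
  finally show ?case by simp
qed auto

text \<open>With the sum of the parameters fixed, the two-step expectation is, up to corrections of
  favourable size or sign, a function of the product \<open>(1 + a) * (1 + b)\<close> alone and
  increases with it. The product is largest when the parameters agree.\<close>

lemma two_point_op_average_aux:
  assumes ab: "0 \<le> a" "a \<le> b"
  defines "m \<equiv> (a + b) / 2"
  shows "two_point_op a (two_point_op b pos_sq) y \<le> two_point_op m (two_point_op m pos_sq) y"
proof -
  \<comment> \<open>The shift by one makes the weights \<open>1 / A\<close> and
    \<open>1 / B\<close>. The four arguments become \<open>z\<close>, \<open>z - A\<close>,
    \<open>z - B\<close> and \<open>z - A - B\<close>, so \<open>z\<close> is the topmost.\<close>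
  define A B M z where "A = 1 + a" and "B = 1 + b" and "M = 1 + m" and "z = y + 2"
  have AB: "1 \<le> A" "A \<le> M" "M \<le> B" "A + B = 2 * M"
    using ab by (auto simp: A_def B_def M_def m_def field_simps)
  define h where "h C D = (pos_sq (z - C - D) + (C - 1) * pos_sq (z - D) + (D - 1) * pos_sq (z - C)
      + (C - 1) * (D - 1) * pos_sq z) / (C * D)" for C D
  have h_eq: "two_point_op (C - 1) (two_point_op (D - 1) pos_sq) y = h C D"
    if "1 \<le> C" "1 \<le> D" for C D
    using that unfolding two_point_op_def h_def z_def
    by (simp add: field_simps)
  have P: "A * B = M\<^sup>2 - (M - A)\<^sup>2" and P0: "0 < A * B"
    using AB by (auto simp: power2_eq_square algebra_simps) (metis distrib_left mult_2)
  then have PM: "A * B \<le> M\<^sup>2" by simp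
  \<comment> \<open>\<open>f1\<close> is the value when only the top argument is positive.
    \<open>f2\<close>, below, is the full second moment without the lowest term, as is right when
    only the lowest argument is negative. Both depend on the parameters through their product
    \<open>p\<close>.\<close>
  define f1 where "f1 p = (1 - (2 * M - 1) / p) * z\<^sup>2" for p
  define f2 where "f2 p = z\<^sup>2 - 4 * z + 2 * M + 2 - (z - 2 * M)\<^sup>2 / p" for p
  have f1_mono: "f1 (A * B) \<le> f1 (M\<^sup>2)"
    unfolding f1_def using PM P0 AB by (intro mult_right_mono diff_left_mono divide_left_mono) auto
  have f2_mono: "f2 (A * B) \<le> f2 (M\<^sup>2)"
    unfolding f2_def using PM P0 AB by (intro diff_left_mono divide_left_mono) auto
  have low: "h C D = f1 (C * D)" if "0 \<le> z" "z \<le> C" "z \<le> D" "1 \<le> C" "1 \<le> D" "C + D = 2 * M" for C D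
    using that unfolding h_def f1_def by (simp add: pos_sq_eq that(6)[symmetric] field_simps)
  have high: "h C D = f2 (C * D)" if "C \<le> z" "D \<le> z" "z \<le> C + D" "1 \<le> C" "1 \<le> D" "C + D = 2 * M" for C D
  proof -
    have "M = (C + D) / 2" using that by simp
    then show ?thesis
      using that(1-5) unfolding h_def f2_def
      by (simp add: pos_sq_eq field_simps power2_eq_square)
  qed
  have "h A B \<le> h M M"
  proof -
    consider "z < 0" | "0 \<le> z" "z \<le> A" | "B \<le> z" "z \<le> 2 * M" | "2 * M < z" | "A \<le> z" "z \<le> M" | "M \<le> z" "z \<le> B"
      by linarith
    then show ?thesis
    proof cases
      case 1
      then show ?thesis using AB by (simp add: h_def pos_sq_eq)
    next
      case 2
      then show ?thesis using low[of A B] low[of M M] f1_mono AB by (simp add: power2_eq_square)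
    next
      case 3
      then show ?thesis using high[of A B] high[of M M] f2_mono AB by (simp add: power2_eq_square)
    next
      case 4
      have *: "h C D = z\<^sup>2 - 4 * z + 2 * M + 2" if "C \<le> z" "D \<le> z" "C + D \<le> z" "1 \<le> C" "1 \<le> D" "C + D = 2 * M" for C D
      proof -
        have "M = (C + D) / 2" using that by simp
        then show ?thesis
          using that(1-5) unfolding h_def
          by (simp add: pos_sq_eq field_simps power2_eq_square)
      qed
      show ?thesis using *[of A B] *[of M M] AB 4 by simp
    next
      case 5
      \<comment> \<open>For \<open>A \<le> z \<le> M\<close> the uneven side has one extra positive
        argument, \<open>z - A\<close>. This inequality, equivalent to \<open>z \<le> M\<close>,
        bounds the extra term by the gain of \<open>f1\<close> from \<open>A * B\<close> to
        \<open>M\<^sup>2\<close>.\<close>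
      have "M * (z - A) \<le> z * (M - A)"
        using 5 AB by (simp add: algebra_simps)
      then have "(M * (z - A))\<^sup>2 \<le> (z * (M - A))\<^sup>2"
        using 5 AB by (intro power_mono) auto
      then have "(B - 1) * (M * (z - A))\<^sup>2 \<le> (2 * M - 1) * (z * (M - A))\<^sup>2"
        using AB by (intro mult_mono) auto
      then have "(B - 1) * (z - A)\<^sup>2 * M\<^sup>2 \<le> (2 * M - 1) * z\<^sup>2 * (M\<^sup>2 - A * B)"
        unfolding P by (simp only: power_mult_distrib diff_diff_eq2 add_diff_cancel_left' mult_ac)
      then have "(B - 1) * (z - A)\<^sup>2 / (A * B) \<le> (2 * M - 1) * z\<^sup>2 * (M\<^sup>2 - A * B) / (M\<^sup>2 * (A * B))"
      proof -
        have "X / p \<le> Y / (q * p)" if "X * q \<le> Y" "0 < p" "0 < q" for X Y p q :: real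
          using that by (simp add: divide_simps)
        then show ?thesis
          using \<open>(B - 1) * (z - A)\<^sup>2 * M\<^sup>2 \<le> _\<close> P0 AB by simp
      qed
      also have "\<dots> = f1 (M\<^sup>2) - f1 (A * B)"
        unfolding f1_def using P0 AB by (simp add: field_simps)
      finally have "f1 (A * B) + (B - 1) * (z - A)\<^sup>2 / (A * B) \<le> f1 (M\<^sup>2)" by simp
      moreover have "h A B = f1 (A * B) + (B - 1) * (z - A)\<^sup>2 / (A * B)"
      proof -
        have "M = (A + B) / 2" "0 < A" "0 < B" using AB by auto
        then show ?thesis
          using 5 AB(1) unfolding h_def f1_def
          by (simp add: pos_sq_eq divide_simps) (simp add: algebra_simps power2_eq_square)
      qed
      ultimately show ?thesis
        using low[of M M] 5 AB by (simp add: power2_eq_square)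
    next
      case 6
      \<comment> \<open>For \<open>M \<le> z \<le> B\<close> the argument \<open>z - B\<close> is
        not positive, yet \<open>f2\<close> counts its square; removing it only lowers the uneven
        side.\<close>
      have "h A B = f2 (A * B) - (A - 1) * (z - B)\<^sup>2 / (A * B)"
      proof -
        have "M = (A + B) / 2" "0 < A" "0 < B" using AB by auto
        then show ?thesis
          using 6 AB(1) unfolding h_def f2_def
          by (simp add: pos_sq_eq divide_simps) (simp add: algebra_simps power2_eq_square)
      qed
      also have "\<dots> \<le> f2 (A * B)"
        using AB P0 by simp
      also have "\<dots> \<le> h M M"
        using high[of M M] f2_mono 6 AB by (simp add: power2_eq_square)
      finally show ?thesis .
    qed
  qed
  then show ?thesis
    using h_eq[of A B] h_eq[of M M] AB by (simp add: A_def B_def M_def)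
qed

lemma two_point_op_average:
  assumes "0 \<le> a" "0 \<le> b"
  shows "two_point_op a (two_point_op b pos_sq) y \<le>
    two_point_op ((a + b) / 2) (two_point_op ((a + b) / 2) pos_sq) y"
  using two_point_op_average_aux[of a b y] two_point_op_average_aux[of b a y] assms
  by (cases "a \<le> b") (auto simp: two_point_op_commute[of a b] add.commute[of b a])

text \<open>Induction on the number of parameters. The hypothesis averages all but one of them;
  repeating this with alternating choices drives every parameter to the common mean, and continuity
  gives the limit.\<close>

lemma two_point_op_funpow_average:
  assumes "0 \<le> s" "0 \<le> c"
  shows "two_point_op s ((two_point_op c ^^ k) pos_sq) y \<le>
    (two_point_op ((s + real k * c) / (real k + 1)) ^^ Suc k) pos_sq y"
  using assms
proof (induction k arbitrary: s c y)
  case (Suc k)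
  show ?case
  proof (cases "k = 0")
    case True
    then show ?thesis using two_point_op_average[OF Suc.prems] by (simp add: funpow_swap1)
  next
    case False
    define K where "K = real (Suc k)"
    \<comment> \<open>Strictness makes the gap contract under the factor \<open>- 1 / K\<close>.
      With \<open>k = 0\<close> it would only change sign, hence the separate appeal to the
      two-variable case.\<close>
    have K: "1 < K" using False by (simp add: K_def)
    define r where "r = s + K * c"
    \<comment> \<open>The total \<open>r\<close> is fixed and \<open>d\<close> is the gap: the first
      parameter is \<open>(r - K * d) / (K + 1)\<close>, the other \<open>K\<close> equal
      \<open>(r + d) / (K + 1)\<close>. \<open>adm d\<close> says that all of them are nonnegative;
      the given \<open>s\<close> and \<open>c\<close> correspond to
      \<open>d = c - s\<close>.\<close>
    define adm where "adm d \<longleftrightarrow> 0 \<le> r - K * d \<and> 0 \<le> r + d" for d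
    define L where "L d = two_point_op ((r - K * d) / (K + 1))
      ((two_point_op ((r + d) / (K + 1)) ^^ Suc k) pos_sq) y" for d
    \<comment> \<open>Averaging the first parameter with all but one of the others divides the gap by \<open>- K\<close>.\<close>
    have step: "L d \<le> L (- d / K) \<and> adm (- d / K)" if "adm d" for d
    proof -
      let ?s = "(r - K * d) / (K + 1)" and ?c = "(r + d) / (K + 1)"
      have nn: "0 \<le> ?s" "0 \<le> ?c" using that K by (auto simp: adm_def)
      have "r \<ge> 0" using that K
        unfolding adm_def by (smt (verit) mult_minus_right mult_nonneg_nonneg)
      then have adm': "adm (- d / K)"
      proof -
        have "d \<le> K * r"
        proof (cases "0 \<le> d")
          case True
          have "1 * d \<le> K * d" "1 * r \<le> K * r"
            using True K \<open>0 \<le> r\<close> by (intro mult_right_mono; simp)+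
          then show ?thesis using that by (simp add: adm_def)
        next
          case False
          have "0 \<le> K * r" using K \<open>0 \<le> r\<close> by simp
          then show ?thesis using False by simp
        qed
        then show ?thesis
          using that K by (simp add: adm_def field_simps)
      qed
      have m: "(?s + real k * ?c) / (real k + 1) = (r + - d / K) / (K + 1)"
      proof -
        have "(?s + (K - 1) * ?c) / K = (r + - d / K) / (K + 1)"
          using K by (simp add: divide_simps) (simp add: algebra_simps)
        then show ?thesis by (simp add: K_def add.commute)
      qed
      \<comment> \<open>One copy of \<open>?c\<close> is moved to the front and the hypothesis
        averages \<open>?s\<close> with the remaining \<open>k\<close> copies. The copy in front is
        then the odd parameter of the new configuration.\<close>
      have "L d = two_point_op ?c (two_point_op ?s ((two_point_op ?c ^^ k) pos_sq)) y"
        unfolding L_def using two_point_op_commute[of ?s ?c] by simp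
      also have "\<dots> \<le> two_point_op ?c ((two_point_op ((r + - d / K) / (K + 1)) ^^ Suc k) pos_sq) y"
        using Suc.IH[OF nn] unfolding m by (intro two_point_op_mono nn)
      also have "\<dots> = L (- d / K)"
        unfolding L_def using K by (simp add: field_simps)
      finally show ?thesis using adm' by simp
    qed
    have iter: "L d \<le> L (d * (- 1 / K) ^ j) \<and> adm (d * (- 1 / K) ^ j)" if "adm d" for d j
    proof (induction j)
      case (Suc j)
      then show ?case using step[of "d * (- 1 / K) ^ j"] by (auto simp: field_simps)
    qed (use that in auto)
    have dc: "adm (c - s)"
      using Suc.prems K unfolding adm_def r_def
      by (simp add: field_simps) 
    have r0: "0 \<le> r / (K + 1)"
      using Suc.prems K by (simp add: r_def)
    have "(\<lambda>j. (- 1 / K) ^ j) \<longlonglongrightarrow> 0"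
      using K by (intro LIMSEQ_power_zero) auto
    then have d0: "(\<lambda>j. (c - s) * (- 1 / K) ^ j) \<longlonglongrightarrow> 0"
      by (rule tendsto_mult_right_zero)
    have "(\<lambda>j. L ((c - s) * (- 1 / K) ^ j)) \<longlonglongrightarrow> two_point_op (r / (K + 1))
      ((two_point_op (r / (K + 1)) ^^ Suc k) pos_sq) y"
    proof -
      have cont: "isCont pos_sq z" for z unfolding pos_sq_def by (intro continuous_intros)
      have 1: "(\<lambda>j. (r - K * ((c - s) * (- 1 / K) ^ j)) / (K + 1)) \<longlonglongrightarrow> r / (K + 1)"
        using tendsto_divide[OF tendsto_diff[OF tendsto_const tendsto_mult[OF tendsto_const d0]] tendsto_const, of "K + 1" r K] K
        by simp
      have 2: "(\<lambda>j. (r + ((c - s) * (- 1 / K) ^ j)) / (K + 1)) \<longlonglongrightarrow> r / (K + 1)"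
        using tendsto_divide[OF tendsto_add[OF tendsto_const d0] tendsto_const, of "K + 1" r] K
        by simp
      show ?thesis
        unfolding L_def two_point_op_def[of _ "(_ ^^ _) _"]
        using r0 by (intro tendsto_intros tendsto_two_point_op_funpow 1 2 cont) auto
    qed
    then have "L (c - s) \<le> (two_point_op (r / (K + 1)) ^^ Suc (Suc k)) pos_sq y"
      using iter[OF dc] by (intro tendsto_lowerbound) (auto intro: always_eventually)
    moreover have "(r - K * (c - s)) / (K + 1) = s" "(r + (c - s)) / (K + 1) = c"
      using K by (auto simp: r_def field_simps)
    ultimately show ?thesis
      unfolding L_def by (simp add: r_def K_def)
  qed
qed simp

text \<open>The majorant is tangent to the square of the positive part at \<open>u = - s\<close> and meets it at \<open>u = 1\<close>.\<close>

definition majorant_quadratic_coeff :: "real \<Rightarrow> real \<Rightarrow> real" where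
  "majorant_quadratic_coeff s y = (if s \<le> y then 1 else pos_sq ((y + 1) / (1 + s)))"

definition majorant_linear_coeff :: "real \<Rightarrow> real \<Rightarrow> real" where
  "majorant_linear_coeff s y = 2 * (if s \<le> y then y else s * majorant_quadratic_coeff s y)"

lemma majorant_quadratic_coeff_bounds:
  assumes "0 \<le> s"
  shows "0 \<le> majorant_quadratic_coeff s y" "majorant_quadratic_coeff s y \<le> 1"
proof -
  have "pos_sq ((y + 1) / (1 + s)) \<le> pos_sq 1" if "y < s"
    using that assms by (intro pos_sq_mono) auto
  then show "0 \<le> majorant_quadratic_coeff s y" "majorant_quadratic_coeff s y \<le> 1"
    by (auto simp: majorant_quadratic_coeff_def pos_sq_nonneg pos_sq_eq)
qed

text \<open>The sign lets a nonpositive conditional mean be discarded; the upper bound gives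
  integrability of the linear term.\<close>

lemma majorant_linear_coeff_bounds:
  assumes "0 \<le> s"
  shows "0 \<le> majorant_linear_coeff s y" "majorant_linear_coeff s y \<le> 2 * max s y"
proof -
  have "s * majorant_quadratic_coeff s y \<le> s * 1"
    using assms majorant_quadratic_coeff_bounds by (intro mult_left_mono) auto
  then show "0 \<le> majorant_linear_coeff s y" "majorant_linear_coeff s y \<le> 2 * max s y"
    using assms by (auto simp: majorant_linear_coeff_def majorant_quadratic_coeff_bounds)
qed

text \<open>For \<open>s \<le> y\<close> the right side is \<open>(y + u)\<^sup>2\<close>. Otherwise
  it is \<open>(w * (u + s))\<^sup>2\<close>, whose root dominates the line \<open>y + u\<close>
  wherever that is nonnegative and \<open>u \<le> 1\<close>, with equality at \<open>u = 1\<close>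
  if \<open>y + 1 \<ge> 0\<close>. It is expanded so that mean at most 0 and second moment
  \<open>s\<close> leave at most the constant term.\<close>

lemma pos_sq_le_majorant:
  assumes "0 \<le> s" "u \<le> 1"
  shows "pos_sq (y + u) \<le> two_point_op s pos_sq y + majorant_linear_coeff s y * u
    + majorant_quadratic_coeff s y * (u\<^sup>2 - s)"
proof (cases "s \<le> y")
  case True
  then show ?thesis
    using pos_sq_le_square[of "y + u"] assms
    by (simp add: two_point_op_pos_sq majorant_linear_coeff_def majorant_quadratic_coeff_def
        power2_eq_square algebra_simps)
next
  case False
  define w where "w = max 0 (y + 1) / (1 + s)"
  have mq: "majorant_quadratic_coeff s y = w\<^sup>2"
    using assms False by (auto simp: majorant_quadratic_coeff_def w_def pos_sq_def max_def field_simps)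
  have tp: "two_point_op s pos_sq y = s * (1 + s) * w\<^sup>2"
  proof -
    have "pos_sq (y + 1) = (w * (1 + s))\<^sup>2"
      using assms by (simp add: w_def pos_sq_def)
    then show ?thesis
      using assms False by (simp add: two_point_op_pos_sq power2_eq_square)
  qed
  have "pos_sq (y + u) \<le> (w * (u + s))\<^sup>2"
  proof (cases "0 \<le> y + u")
    case True
    have "0 \<le> (s - y) * (1 - u)" using False assms by auto
    then have "(y + u) * (1 + s) \<le> (y + 1) * (u + s)"
      by (simp add: algebra_simps)
    then have "y + u \<le> w * (u + s)"
      using assms True by (simp add: w_def field_simps)
    then show ?thesis using True by (simp add: pos_sq_eq power_mono)
  qed (simp add: pos_sq_eq)
  also have "\<dots> = s * (1 + s) * w\<^sup>2 + 2 * (s * w\<^sup>2) * u + w\<^sup>2 * (u\<^sup>2 - s)"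
    by (simp add: power2_eq_square algebra_simps)
  finally show ?thesis
    using False by (simp add: tp mq majorant_linear_coeff_def)
qed

text \<open>With \<open>u\<close> fixed, the remaining operators act on the majorant in its variable
  \<open>y\<close>; they are monotone and linear, and commute with shifts and with
  \<open>two_point_op s\<close>.\<close>

lemma two_point_op_funpow_pos_sq_le_majorant:
  assumes "0 \<le> s" "0 \<le> c" "u \<le> 1"
  shows "(two_point_op c ^^ k) pos_sq (y + u) \<le> two_point_op s ((two_point_op c ^^ k) pos_sq) y
    + (two_point_op c ^^ k) (majorant_linear_coeff s) y * u
    + (two_point_op c ^^ k) (majorant_quadratic_coeff s) y * (u\<^sup>2 - s)"
proof -
  have "(two_point_op c ^^ k) pos_sq (y + u) = (two_point_op c ^^ k) (\<lambda>z. pos_sq (z + u)) y"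
    by (simp add: two_point_op_funpow_shift)
  also have "\<dots> \<le> (two_point_op c ^^ k) (\<lambda>z. two_point_op s pos_sq z + majorant_linear_coeff s z * u
    + majorant_quadratic_coeff s z * (u\<^sup>2 - s)) y"
    by (intro two_point_op_funpow_mono pos_sq_le_majorant assms)
  finally show ?thesis
    by (simp add: two_point_op_funpow_linear two_point_op_funpow_commute assms)
qed

section \<open>The supermartingale step\<close>

lemma two_point_op_funpow_split:
  assumes "0 \<le> s" "s \<le> r"
  shows "two_point_op s ((two_point_op ((r - s) / real j) ^^ j) pos_sq) y \<le>
    (two_point_op (r / real (Suc j)) ^^ Suc j) pos_sq y"
\<comment> \<open>For \<open>j = 0\<close> the quotient is a division by zero under a power that is
  the identity; the unspent variance is absorbed by monotonicity.\<close>
proof (cases "j = 0")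
  case True
  then show ?thesis using two_point_op_pos_sq_mono[OF assms] by simp
next
  case False
  then have "(s + real j * ((r - s) / real j)) / (real j + 1) = r / real (Suc j)"
    by (simp add: add.commute)
  then show ?thesis
    using two_point_op_funpow_average[of s "(r - s) / real j" j y] assms by simp
qed

lemma (in prob_space) integrable_two_point_op_funpow:
  fixes c y :: "'a \<Rightarrow> real"
  assumes [measurable]: "A \<in> sets M" "c \<in> borel_measurable M" "y \<in> borel_measurable M"
    and c: "\<And>\<omega>. \<omega> \<in> A \<Longrightarrow> 0 \<le> c \<omega>"
    and y: "AE \<omega> in M. y \<omega> \<le> K"
  shows "integrable M (\<lambda>\<omega>. indicator A \<omega> * (two_point_op (c \<omega>) ^^ k) pos_sq (y \<omega>))"
proof (rule integrable_const_bound)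
  have [measurable]: "(\<lambda>\<omega>. (two_point_op (c \<omega>) ^^ k) pos_sq (y \<omega>)) \<in> borel_measurable M"
    by (intro measurable_two_point_op_funpow) measurable
  show "(\<lambda>\<omega>. indicator A \<omega> * (two_point_op (c \<omega>) ^^ k) pos_sq (y \<omega>)) \<in> borel_measurable M"
    by measurable
  show "AE \<omega> in M. norm (indicator A \<omega> * (two_point_op (c \<omega>) ^^ k) pos_sq (y \<omega>)) \<le> pos_sq (K + k)"
    using y
  proof eventually_elim
    case (elim \<omega>)
    show ?case
    proof (cases "\<omega> \<in> A")
      case True
      have "(two_point_op (c \<omega>) ^^ k) pos_sq (y \<omega>) \<le> pos_sq (K + k)"
        using elim c[OF True] by (intro two_point_op_funpow_le) (auto intro: pos_sq_mono)
      then show ?thesis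
        using True two_point_op_funpow_nonneg[OF c[OF True], of pos_sq k "y \<omega>"] pos_sq_nonneg by simp
    qed (simp add: pos_sq_nonneg)
  qed
qed

text \<open>The pointwise majorant is integrated with coefficients measurable in \<open>F\<close>.
  The linear term is at most 0 by the drift condition, and the quadratic term vanishes because
  \<open>s\<close> is the conditional second moment on \<open>A\<close>.\<close>

lemma (in prob_space) integral_supermartingale_step:
  fixes X y s c :: "'a \<Rightarrow> real"
  assumes sub: "subalgebra M F"
    and X: "integrable M X" "AE \<omega> in M. X \<omega> \<le> 1" "AE \<omega> in M. real_cond_exp M F X \<omega> \<le> 0"
    and A: "A \<in> sets F"
    and meas [measurable]: "y \<in> borel_measurable F" "s \<in> borel_measurable F" "c \<in> borel_measurable F"
    and bnd: "\<And>\<omega>. \<omega> \<in> A \<Longrightarrow> 0 \<le> s \<omega>" "\<And>\<omega>. \<omega> \<in> A \<Longrightarrow> s \<omega> \<le> r" "\<And>\<omega>. \<omega> \<in> A \<Longrightarrow> 0 \<le> c \<omega>"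
    and y: "AE \<omega> in M. y \<omega> \<le> K"
    and var: "\<And>\<omega>. \<omega> \<in> A \<Longrightarrow> nn_cond_exp M F (\<lambda>\<omega>. ennreal ((X \<omega>)\<^sup>2)) \<omega> = ennreal (s \<omega>)"
  shows "(\<integral>\<omega>. indicator A \<omega> * (two_point_op (c \<omega>) ^^ k) pos_sq (y \<omega> + X \<omega>) \<partial>M) \<le>
    (\<integral>\<omega>. indicator A \<omega> * two_point_op (s \<omega>) ((two_point_op (c \<omega>) ^^ k) pos_sq) (y \<omega>) \<partial>M)"
proof -
  interpret S: finite_measure_subalgebra M F
    by unfold_locales (rule sub)
  note fromF = measurable_from_subalg[OF sub]
  have measM [measurable]: "y \<in> borel_measurable M" "s \<in> borel_measurable M" "c \<in> borel_measurable M"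
    using meas by (auto intro: fromF)
  have [measurable]: "X \<in> borel_measurable M" using X(1) by simp
  have AM [measurable]: "A \<in> sets M" using A sub by (auto simp: subalgebra_def)
  define Q1 where "Q1 \<omega> = indicator A \<omega> * (two_point_op (c \<omega>) ^^ k) (majorant_linear_coeff (s \<omega>)) (y \<omega>)" for \<omega>
  define Q2 where "Q2 \<omega> = indicator A \<omega> * (two_point_op (c \<omega>) ^^ k) (majorant_quadratic_coeff (s \<omega>)) (y \<omega>)" for \<omega>
  note [measurable] = A
  have coeff: "(\<lambda>\<omega>. majorant_linear_coeff (s \<omega>) (z \<omega>)) \<in> borel_measurable F"
    "(\<lambda>\<omega>. majorant_quadratic_coeff (s \<omega>) (z \<omega>)) \<in> borel_measurable F"
    if [measurable]: "z \<in> borel_measurable F" for z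
    unfolding majorant_linear_coeff_def majorant_quadratic_coeff_def by measurable
  have Q1F: "Q1 \<in> borel_measurable F" and Q2F: "Q2 \<in> borel_measurable F"
    unfolding Q1_def Q2_def
    by (intro borel_measurable_times borel_measurable_indicator A measurable_two_point_op_funpow meas coeff;
        assumption)+
  have [measurable]: "Q1 \<in> borel_measurable M" "Q2 \<in> borel_measurable M"
    using Q1F Q2F by (auto intro: fromF)
  \<comment> \<open>The inner operator evaluates the linear coefficient at arguments up to
    \<open>y \<omega> + real k\<close>, which is almost surely at most
    \<open>K + real k\<close>.\<close>
  define C where "C = 2 * max (max 0 r) (K + real k)"
  have Q1_nonneg: "0 \<le> Q1 \<omega>" and Q2_nonneg: "0 \<le> Q2 \<omega>" and Q2_le: "Q2 \<omega> \<le> 1" for \<omega>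
    unfolding Q1_def Q2_def using bnd
    by (auto simp: indicator_def intro!: two_point_op_funpow_nonneg two_point_op_funpow_le
        majorant_linear_coeff_bounds majorant_quadratic_coeff_bounds)
  have Q1_le: "AE \<omega> in M. Q1 \<omega> \<le> C"
    using y
  proof eventually_elim
    case (elim \<omega>)
    show ?case
    proof (cases "\<omega> \<in> A")
      case True
      have "majorant_linear_coeff (s \<omega>) z \<le> C" if "z \<le> y \<omega> + real k" for z
      proof -
        have "2 * max (s \<omega>) z \<le> C"
          unfolding C_def using that elim bnd(2)[OF True] by (intro mult_left_mono max.mono) auto
        then show ?thesis
          using majorant_linear_coeff_bounds(2)[OF bnd(1)[OF True], of z] by (rule order_trans[rotated])
      qed
      then show ?thesis
        using True bnd(3)[OF True] by (auto simp: Q1_def intro: two_point_op_funpow_le)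
    qed (simp add: Q1_def C_def)
  qed
  have int1: "integrable M (\<lambda>\<omega>. Q1 \<omega> * X \<omega>)"
  proof (rule Bochner_Integration.integrable_bound[OF integrable_mult_right[OF integrable_abs[OF X(1)], of C]])
    show "AE \<omega> in M. norm (Q1 \<omega> * X \<omega>) \<le> norm (C * \<bar>X \<omega>\<bar>)"
      using Q1_le Q1_nonneg by (auto simp: abs_mult intro!: mult_right_mono)
  qed measurable
  have le1: "(\<integral>\<omega>. Q1 \<omega> * X \<omega> \<partial>M) \<le> 0"
  proof -
    have "(\<integral>\<omega>. Q1 \<omega> * X \<omega> \<partial>M) = (\<integral>\<omega>. Q1 \<omega> * real_cond_exp M F X \<omega> \<partial>M)"
      by (rule S.real_cond_exp_intg(2)[symmetric, OF int1 Q1F]) measurable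
    also have "\<dots> \<le> (\<integral>\<omega>. 0 \<partial>M)"
    proof (rule integral_mono_AE)
      show "AE \<omega> in M. Q1 \<omega> * real_cond_exp M F X \<omega> \<le> 0"
        using X(3) by eventually_elim (auto intro: mult_nonneg_nonpos Q1_nonneg)
    qed (use S.real_cond_exp_intg(1)[OF int1 Q1F] in auto)
    finally show ?thesis by simp
  qed
  have Q2s: "integrable M (\<lambda>\<omega>. Q2 \<omega> * s \<omega>)"
  proof (rule integrable_const_bound[where B="max 0 r"])
    have "norm (Q2 \<omega> * s \<omega>) \<le> max 0 r" for \<omega>
    proof (cases "\<omega> \<in> A")
      case True
      have "Q2 \<omega> * s \<omega> \<le> 1 * r"
        using True bnd Q2_le Q2_nonneg by (intro mult_mono) auto
      then show ?thesis using True bnd Q2_nonneg by (simp add: abs_mult)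
    qed (simp add: Q2_def)
    then show "AE \<omega> in M. norm (Q2 \<omega> * s \<omega>) \<le> max 0 r" by simp
  qed measurable
  have Q2s_nonneg: "0 \<le> Q2 \<omega> * s \<omega>" for \<omega>
    using Q2_nonneg[of \<omega>] bnd by (cases "\<omega> \<in> A") (auto simp: Q2_def)
  \<comment> \<open>Square-integrability of \<open>X\<close> is not assumed. The identity is proved
    in the extended half-line, where finiteness of the right side makes
    \<open>Q2 \<omega> * (X \<omega>)\<^sup>2\<close> integrable; \<open>Q2\<close> vanishes off
    \<open>A\<close>.\<close>
  have nn: "(\<integral>\<^sup>+\<omega>. ennreal (Q2 \<omega> * (X \<omega>)\<^sup>2) \<partial>M) = ennreal (\<integral>\<omega>. Q2 \<omega> * s \<omega> \<partial>M)"
  proof -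
    have "(\<integral>\<^sup>+\<omega>. ennreal (Q2 \<omega> * (X \<omega>)\<^sup>2) \<partial>M) = (\<integral>\<^sup>+\<omega>. ennreal (Q2 \<omega>) * ennreal ((X \<omega>)\<^sup>2) \<partial>M)"
      by (simp add: ennreal_mult Q2_nonneg)
    also have "\<dots> = (\<integral>\<^sup>+\<omega>. ennreal (Q2 \<omega>) * nn_cond_exp M F (\<lambda>\<omega>. ennreal ((X \<omega>)\<^sup>2)) \<omega> \<partial>M)"
      by (rule S.nn_cond_exp_intg[symmetric]) (use Q2F in measurable)
    also have "\<dots> = (\<integral>\<^sup>+\<omega>. ennreal (Q2 \<omega> * s \<omega>) \<partial>M)"
      using bnd(1) var by (intro nn_integral_cong) (auto simp: Q2_def indicator_def ennreal_mult'')
    also have "\<dots> = ennreal (\<integral>\<omega>. Q2 \<omega> * s \<omega> \<partial>M)"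
      by (intro nn_integral_eq_integral Q2s) (simp add: Q2s_nonneg)
    finally show ?thesis .
  qed
  have int2: "integrable M (\<lambda>\<omega>. Q2 \<omega> * (X \<omega>)\<^sup>2)"
    by (rule integrableI_nonneg) (auto simp: nn Q2_nonneg)
  have eq2: "(\<integral>\<omega>. Q2 \<omega> * (X \<omega>)\<^sup>2 \<partial>M) = (\<integral>\<omega>. Q2 \<omega> * s \<omega> \<partial>M)"
    by (subst integral_eq_nn_integral)
      (auto simp: nn Q2_nonneg intro!: enn2real_ennreal integral_nonneg_AE Q2s_nonneg)
  define T where "T \<omega> = indicator A \<omega> * two_point_op (s \<omega>) ((two_point_op (c \<omega>) ^^ k) pos_sq) (y \<omega>)" for \<omega>
  have intT: "integrable M T"
  proof (rule integrable_const_bound)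
    \<comment> \<open>The outer operator is written as a first power so that the measurability lemma
      for powers covers it, with the inner power as its function.\<close>
    have "(\<lambda>\<omega>. (two_point_op (s \<omega>) ^^ 1) ((two_point_op (c \<omega>) ^^ k) pos_sq) (y \<omega>)) \<in> borel_measurable M"
    proof (rule measurable_two_point_op_funpow)
      show "(\<lambda>\<omega>. (two_point_op (c \<omega>) ^^ k) pos_sq (z \<omega>)) \<in> borel_measurable M"
        if [measurable]: "z \<in> borel_measurable M" for z
        by (rule measurable_two_point_op_funpow) measurable
    qed measurable
    then show "T \<in> borel_measurable M"
      unfolding T_def by simp
    show "AE \<omega> in M. norm (T \<omega>) \<le> pos_sq (K + 1 + k)"
      using y
    proof eventually_elim
      case (elim \<omega>)
      show ?case
      proof (cases "\<omega> \<in> A")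
        case True
        have "(two_point_op (c \<omega>) ^^ k) pos_sq z \<le> pos_sq (K + 1 + k)" if "z \<le> y \<omega> + 1" for z
          using elim that bnd(3)[OF True] by (intro two_point_op_funpow_le) (auto intro: pos_sq_mono)
        then have "(two_point_op (s \<omega>) ^^ 1) ((two_point_op (c \<omega>) ^^ k) pos_sq) (y \<omega>) \<le> pos_sq (K + 1 + k)"
          using bnd(1)[OF True] by (intro two_point_op_funpow_le[where k=1]) auto
        moreover have "0 \<le> (two_point_op (s \<omega>) ^^ 1) ((two_point_op (c \<omega>) ^^ k) pos_sq) (y \<omega>)"
          using bnd[OF True] by (intro two_point_op_funpow_nonneg pos_sq_nonneg)
        ultimately show ?thesis using True by (simp add: T_def)
      qed (simp add: T_def pos_sq_nonneg)
    qed
  qed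
  have "(\<integral>\<omega>. indicator A \<omega> * (two_point_op (c \<omega>) ^^ k) pos_sq (y \<omega> + X \<omega>) \<partial>M) \<le>
      (\<integral>\<omega>. T \<omega> + Q1 \<omega> * X \<omega> + (Q2 \<omega> * (X \<omega>)\<^sup>2 - Q2 \<omega> * s \<omega>) \<partial>M)"
  proof (rule integral_mono_AE)
    show "integrable M (\<lambda>\<omega>. indicator A \<omega> * (two_point_op (c \<omega>) ^^ k) pos_sq (y \<omega> + X \<omega>))"
      using y X(2) bnd(3) by (intro integrable_two_point_op_funpow[where K="K + 1"]) (measurable, auto)
    show "AE \<omega> in M. indicator A \<omega> * (two_point_op (c \<omega>) ^^ k) pos_sq (y \<omega> + X \<omega>) \<le>
        T \<omega> + Q1 \<omega> * X \<omega> + (Q2 \<omega> * (X \<omega>)\<^sup>2 - Q2 \<omega> * s \<omega>)"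
      using X(2)
    proof eventually_elim
      case (elim \<omega>)
      show ?case
      proof (cases "\<omega> \<in> A")
        case True
        then show ?thesis
          using two_point_op_funpow_pos_sq_le_majorant[OF bnd(1)[OF True] bnd(3)[OF True] elim, of k "y \<omega>"]
          by (simp add: T_def Q1_def Q2_def right_diff_distrib)
      qed (simp add: T_def Q1_def Q2_def)
    qed
  qed (intro Bochner_Integration.integrable_add Bochner_Integration.integrable_diff intT int1 int2 Q2s)
  also have "\<dots> = (\<integral>\<omega>. T \<omega> \<partial>M) + (\<integral>\<omega>. Q1 \<omega> * X \<omega> \<partial>M)"
    using eq2 by (simp add: intT int1 int2 Q2s)
  finally show ?thesis using le1 by (simp add: T_def)
qed

section \<open>The maximal inequality for the tail events\<close>

lemma (in prob_space) tail_event_union_le: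
  assumes sd: "supermartingale_difference M F X"
    and X1: "\<And>i. AE \<omega> in M. X i \<omega> \<le> 1"
    and h: "0 < h"
  shows "h\<^sup>2 * prob (\<Union>k\<in>{1..n}. tail_event M F X x v k) \<le>
    (two_point_op (v\<^sup>2 / real n) ^^ n) pos_sq (h - x)"
proof -
  have sub: "subalgebra M (F i)" and adapted: "X i \<in> borel_measurable (F i)"
    and int: "integrable M (X i)" for i
    using sd by (auto simp: supermartingale_difference_def)
  have drift: "AE \<omega> in M. real_cond_exp M (F k) (X (Suc k)) \<omega> \<le> 0" for k
    using sd unfolding supermartingale_difference_def by (metis diff_Suc_1 le_add1 plus_1_eq_Suc)
  have filt: "sets (F i) \<subseteq> sets (F j)" if "i \<le> j" for i j
    using sd that unfolding supermartingale_difference_def filtration_def by blast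
  have spaceF [simp]: "space (F i) = space M" for i
    using sub[of i] by (simp add: subalgebra_def)
  have subF: "subalgebra (F j) (F i)" if "i \<le> j" for i j
    using filt[OF that] by (simp add: subalgebra_def)
  define V where "V k \<omega> = (\<Sum>i=1..k. cond_second_moment M F X i \<omega>)" for k \<omega>
  define S where "S k \<omega> = (\<Sum>i=1..k. X i \<omega>)" for k \<omega>
  have V_Suc: "V (Suc k) \<omega> = V k \<omega> + cond_second_moment M F X (Suc k) \<omega>"
    and S_Suc: "S (Suc k) \<omega> = S k \<omega> + X (Suc k) \<omega>" for k \<omega>
    by (simp_all add: V_def S_def)
  have csm_meas: "cond_second_moment M F X (Suc k) \<in> borel_measurable (F k)" for k
    by (simp add: cond_second_moment_def)
  \<comment> \<open>The accumulated variance is predictable, so whether the next step exceeds the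
    budget is decided before its increment is revealed.\<close>
  have V_pred: "V (Suc k) \<in> borel_measurable (F k)" for k
    unfolding V_def[abs_def]
  proof (intro borel_measurable_sum)
    fix i assume "i \<in> {1..Suc k}"
    then obtain j where "i = Suc j" "j \<le> k" by (cases i) auto
    then show "cond_second_moment M F X i \<in> borel_measurable (F k)"
      using csm_meas[of j] by (auto intro: measurable_from_subalg[OF subF])
  qed
  have V_meas: "V k \<in> borel_measurable (F k)" for k
  proof (cases k)
    case 0 then show ?thesis by (simp add: V_def[abs_def])
  next
    case (Suc j) then show ?thesis using measurable_from_subalg[OF subF V_pred[of j], of k] by simp
  qed
  have S_meas: "S k \<in> borel_measurable (F k)" for k
    unfolding S_def[abs_def]
    by (intro borel_measurable_sum measurable_from_subalg[OF subF adapted]) auto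
  have S_le: "AE \<omega> in M. S k \<omega> \<le> real k" for k
  proof (induction k)
    case (Suc k)
    then show ?case using X1[of "Suc k"] by eventually_elim (simp add: S_Suc)
  qed (simp add: S_def)
  define B where "B k = {\<omega> \<in> space M. V k \<omega> \<le> ennreal (v\<^sup>2)}" for k
  define E where "E k = tail_event M F X x v k" for k
  define U where "U k = (\<Union>j\<in>{1..k}. E j)" for k
  have B_pred: "B (Suc k) \<in> sets (F k)" and B_meas: "B k \<in> sets (F k)" for k
    using measurable_sets[OF V_pred[of k], of "{..ennreal (v\<^sup>2)}"]
      measurable_sets[OF V_meas[of k], of "{..ennreal (v\<^sup>2)}"]
    by (auto simp: B_def vimage_def Int_def conj_commute)
  have E_eq: "E k = B k \<inter> {\<omega> \<in> space M. x \<le> S k \<omega>}" for k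
    by (auto simp: E_def tail_event_def B_def S_def V_def)
  have E_meas: "E k \<in> sets (F k)" for k
    unfolding E_eq using measurable_sets[OF S_meas[of k], of "{x..}"]
    by (intro sets.Int B_meas) (simp add: vimage_def Int_def conj_commute)
  have U_meas: "U k \<in> sets (F k)" for k
    unfolding U_def using E_meas filt by (intro sets.finite_UN) auto
  have U_Suc: "U (Suc k) = U k \<union> E (Suc k)" for k
    by (simp add: U_def atLeastAtMostSuc_conv Un_commute)
  have toM: "A \<in> sets M" if "A \<in> sets (F k)" for A k
    using that sub[of k] by (auto simp: subalgebra_def)
  \<comment> \<open>\<open>enn2real\<close> sends an infinite \<open>V\<close> to 0. Below,
    \<open>R\<close> enters the integrands only under indicators of sets where \<open>V\<close> is
    at most the budget.\<close>
  define R where "R k \<omega> = v\<^sup>2 - enn2real (V k \<omega>)" for k \<omega>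
  have R_meas: "R k \<in> borel_measurable (F k)" for k
    unfolding R_def[abs_def] using V_meas by simp
  have R_pred: "R (Suc k) \<in> borel_measurable (F k)" for k
    unfolding R_def[abs_def] using V_pred by simp
  have R_nonneg: "0 \<le> R k \<omega>" if "\<omega> \<in> B k" for k \<omega>
    using enn2real_mono[of "V k \<omega>" "ennreal (v\<^sup>2)"] that by (simp add: B_def R_def)
  define W where "W j r y = (two_point_op (r / real j) ^^ j) pos_sq y" for j r y
  \<comment> \<open>The process is also killed once an event has occurred: from then on
    \<open>h\<^sup>2 * prob (U k)\<close> accounts for that part, and the sum of the two terms is
    nonincreasing in \<open>k\<close>.\<close>
  define Z where "Z k \<omega> = indicator (B k - U k) \<omega> * W (n - k) (R k \<omega>) (h - x + S k \<omega>)" for k \<omega>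
  have Z_int: "integrable M (Z k)" for k
    unfolding Z_def W_def using S_le[of k] U_meas[of k] B_meas[of k]
    by (intro integrable_two_point_op_funpow[where K="h - x + k"])
      (auto intro!: toM[of _ k] borel_measurable_divide borel_measurable_add measurable_from_subalg[OF sub] R_meas S_meas R_nonneg divide_nonneg_nonneg)
  have Z_nonneg: "0 \<le> Z k \<omega>" for k \<omega>
    unfolding Z_def W_def
    by (auto simp: indicator_def intro!: two_point_op_funpow_nonneg pos_sq_nonneg R_nonneg divide_nonneg_nonneg)
  have step: "h\<^sup>2 * prob (U (Suc k)) + expectation (Z (Suc k)) \<le> h\<^sup>2 * prob (U k) + expectation (Z k)"
    if k: "k < n" for k
  proof -
    define j where "j = n - Suc k"
    have j: "n - k = Suc j" using k by (simp add: j_def)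
    define A where "A = B (Suc k) - U k"
    have A: "A \<in> sets (F k)" unfolding A_def using B_pred U_meas by auto
    define y where "y \<omega> = h - x + S k \<omega>" for \<omega>
    define s where "s \<omega> = enn2real (cond_second_moment M F X (Suc k) \<omega>)" for \<omega>
    define D where "D = U (Suc k) - U k"
    have D: "D \<in> sets M" unfolding D_def using U_meas toM by blast
    \<comment> \<open>On \<open>A\<close> the accumulated variance stays within a finite budget, so
      all terms are finite and \<open>enn2real\<close> is additive there.\<close>
    have *: "cond_second_moment M F X (Suc k) \<omega> = ennreal (s \<omega>) \<and> R (Suc k) \<omega> = R k \<omega> - s \<omega>
        \<and> \<omega> \<in> B k \<and> 0 \<le> R (Suc k) \<omega>" if "\<omega> \<in> A" for \<omega>
    proof -
      have le: "V (Suc k) \<omega> \<le> ennreal (v\<^sup>2)" and sp: "\<omega> \<in> space M" using that by (auto simp: A_def B_def)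
      then have fin: "V k \<omega> < \<top>" "cond_second_moment M F X (Suc k) \<omega> < \<top>"
        using order_le_less_trans[OF le ennreal_less_top] by (auto simp: V_Suc)
      have "V k \<omega> \<le> V (Suc k) \<omega>" by (simp add: V_Suc)
      then have "\<omega> \<in> B k" using le sp by (simp add: B_def)
      moreover have "0 \<le> R (Suc k) \<omega>" using that by (auto simp: A_def intro: R_nonneg)
      ultimately show ?thesis
        using fin by (simp add: s_def R_def V_Suc enn2real_plus)
    qed
    have yX: "h - x + S (Suc k) \<omega> = y \<omega> + X (Suc k) \<omega>" for \<omega>
      by (simp add: y_def S_Suc)
    have c_nonneg: "0 \<le> R (Suc k) \<omega> / real j" if "\<omega> \<in> A" for \<omega>
      using *[OF that] by simp
    have y_le: "AE \<omega> in M. y \<omega> \<le> h - x + k"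
      using S_le[of k] by eventually_elim (simp add: y_def)
    have yF: "y \<in> borel_measurable (F k)"
      unfolding y_def[abs_def] using S_meas by simp
    have cF: "(\<lambda>\<omega>. R (Suc k) \<omega> / real j) \<in> borel_measurable (F k)"
      using R_pred by simp
    have "h\<^sup>2 * prob D + expectation (Z (Suc k)) = (\<integral>\<omega>. h\<^sup>2 * indicator D \<omega> + Z (Suc k) \<omega> \<partial>M)"
      using D by (subst Bochner_Integration.integral_add) (auto intro!: Z_int integrable_mult_right integrable_real_indicator simp: emeasure_eq_measure)
    also have "\<dots> \<le> (\<integral>\<omega>. indicator A \<omega> * (two_point_op (R (Suc k) \<omega> / real j) ^^ j) pos_sq (y \<omega> + X (Suc k) \<omega>) \<partial>M)"
    proof (rule integral_mono)
      show "integrable M (\<lambda>\<omega>. indicator A \<omega> * (two_point_op (R (Suc k) \<omega> / real j) ^^ j) pos_sq (y \<omega> + X (Suc k) \<omega>))"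
        using y_le X1[of "Suc k"] int[of "Suc k"]
        by (intro integrable_two_point_op_funpow[where K="h - x + k + 1"] c_nonneg
            borel_measurable_add measurable_from_subalg[OF sub yF] measurable_from_subalg[OF sub cF] toM[OF A]) auto
      fix \<omega>
      show "h\<^sup>2 * indicator D \<omega> + Z (Suc k) \<omega> \<le>
          indicator A \<omega> * (two_point_op (R (Suc k) \<omega> / real j) ^^ j) pos_sq (y \<omega> + X (Suc k) \<omega>)"
      \<comment> \<open>On the newly hit set \<open>D\<close> the killed process is 0, and
        \<open>h\<^sup>2\<close> is at most \<open>pos_sq\<close> of the current argument, hence at
        most the operator power. Off \<open>D\<close> the left side is just
        \<open>Z (Suc k)\<close>.\<close>
      proof (cases "\<omega> \<in> D")
        case True
        then have "\<omega> \<in> E (Suc k)" "\<omega> \<notin> U k" by (auto simp: D_def U_Suc)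
        then have A': "\<omega> \<in> A" and S: "x \<le> S (Suc k) \<omega>" by (auto simp: E_eq A_def)
        have "h\<^sup>2 = pos_sq h" using h by (simp add: pos_sq_eq)
        also have "\<dots> \<le> pos_sq (y \<omega> + X (Suc k) \<omega>)"
          using S by (intro pos_sq_mono) (simp flip: yX)
        also have "\<dots> \<le> (two_point_op (R (Suc k) \<omega> / real j) ^^ j) pos_sq (y \<omega> + X (Suc k) \<omega>)"
          using c_nonneg[OF A'] by (rule pos_sq_le_two_point_op_funpow)
        finally show ?thesis
          using True A' by (simp add: Z_def D_def)
      next
        case False
        then have "\<omega> \<in> B (Suc k) - U (Suc k) \<longleftrightarrow> \<omega> \<in> A \<and> \<omega> \<notin> U (Suc k)"
          by (auto simp: A_def D_def U_Suc)
        then show ?thesis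
          using False c_nonneg[of \<omega>]
          by (auto simp: Z_def W_def j_def yX indicator_def intro!: two_point_op_funpow_nonneg pos_sq_nonneg)
      qed
    qed (use D in \<open>auto intro!: Bochner_Integration.integrable_add Z_int integrable_mult_right
        integrable_real_indicator simp: emeasure_eq_measure\<close>)
    also have "\<dots> \<le> (\<integral>\<omega>. indicator A \<omega> * two_point_op (s \<omega>) ((two_point_op (R (Suc k) \<omega> / real j) ^^ j) pos_sq) (y \<omega>) \<partial>M)"
    proof (rule integral_supermartingale_step[OF sub[of k] int X1 drift A yF _ cF _ _ _ y_le])
      show "s \<in> borel_measurable (F k)" unfolding s_def[abs_def] using csm_meas by simp
      fix \<omega> assume \<omega>: "\<omega> \<in> A"
      show "0 \<le> s \<omega>" by (simp add: s_def)
      have "R k \<omega> \<le> v\<^sup>2" by (simp add: R_def)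
      then show "s \<omega> \<le> v\<^sup>2" using *[OF \<omega>] by simp
      show "0 \<le> R (Suc k) \<omega> / real j" by (rule c_nonneg[OF \<omega>])
      show "nn_cond_exp M (F k) (\<lambda>\<omega>. ennreal ((X (Suc k) \<omega>)\<^sup>2)) \<omega> = ennreal (s \<omega>)"
        using *[OF \<omega>] by (simp add: cond_second_moment_def)
    qed
    also have "\<dots> \<le> expectation (Z k)"
    proof (rule integral_mono_AE')
      show "integrable M (Z k)" by (rule Z_int)
      have "indicator A \<omega> * two_point_op (s \<omega>) ((two_point_op (R (Suc k) \<omega> / real j) ^^ j) pos_sq) (y \<omega>) \<le> Z k \<omega>" for \<omega>
      proof (cases "\<omega> \<in> A")
        case True
        \<comment> \<open>Spending \<open>s \<omega>\<close> now and spreading the rest over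
          \<open>j\<close> steps is no better than spreading the whole budget over
          \<open>Suc j\<close> steps.\<close>
        have "two_point_op (s \<omega>) ((two_point_op ((R k \<omega> - s \<omega>) / real j) ^^ j) pos_sq) (y \<omega>) \<le> W (Suc j) (R k \<omega>) (y \<omega>)"
          unfolding W_def using *[OF True] by (intro two_point_op_funpow_split) (auto simp: s_def)
        then show ?thesis
          using *[OF True] True by (simp add: Z_def j y_def A_def)
      qed (simp add: Z_nonneg)
      then show "AE \<omega> in M. indicator A \<omega> * two_point_op (s \<omega>) ((two_point_op (R (Suc k) \<omega> / real j) ^^ j) pos_sq) (y \<omega>) \<le> Z k \<omega>"
        by simp
      show "AE \<omega> in M. 0 \<le> Z k \<omega>" by (simp add: Z_nonneg)
    qed
    finally have "h\<^sup>2 * prob D + expectation (Z (Suc k)) \<le> expectation (Z k)" .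
    moreover have "prob (U (Suc k)) = prob (U k) + prob D"
      unfolding D_def
      by (subst finite_measure_Diff[OF toM[OF U_meas] toM[OF U_meas]]) (auto simp: U_Suc)
    ultimately show ?thesis by (simp add: algebra_simps)
  qed
  have "h\<^sup>2 * prob (U k) + expectation (Z k) \<le> expectation (Z 0)" if "k \<le> n" for k
    using that
  proof (induction k)
    case (Suc k)
    then show ?case using step[of k] by simp
  qed (simp add: U_def)
  from this[of n] have "h\<^sup>2 * prob (U n) + expectation (Z n) \<le> expectation (Z 0)"
    by simp
  moreover have "0 \<le> expectation (Z n)"
    by (intro integral_nonneg_AE) (simp add: Z_nonneg)
  ultimately have "h\<^sup>2 * prob (U n) \<le> expectation (Z 0)"
    by linarith
  also have "\<dots> \<le> expectation (\<lambda>_. W n (v\<^sup>2) (h - x))"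
  proof (rule integral_mono)
    have "0 \<le> W n (v\<^sup>2) (h - x)"
      unfolding W_def by (intro two_point_op_funpow_nonneg pos_sq_nonneg) simp
    then show "Z 0 \<omega> \<le> W n (v\<^sup>2) (h - x)" for \<omega>
      by (simp add: Z_def R_def V_def S_def indicator_def)
  qed (auto intro: Z_int)
  finally show ?thesis
    by (simp add: U_def E_def W_def prob_space)
qed

section \<open>Comparison with the Poisson distribution\<close>

lemma exp_series_binomial:
  fixes a b :: real
  shows "(\<Sum>i\<le>n. a ^ i / fact i * (b ^ (n - i) / fact (n - i))) = (a + b) ^ n / fact n"
  using exp_series_add_commuting[of a b n] by (simp add: scaleR_conv_of_real divide_inverse mult.commute)

lemma poisson_pmf_add:
  assumes "0 < a" "0 < b"
  shows "map_pmf (\<lambda>(i, j). i + j) (pair_pmf (poisson_pmf a) (poisson_pmf b)) = poisson_pmf (a + b)"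
proof (rule pmf_eqI)
  fix n :: nat
  let ?p = "pair_pmf (poisson_pmf a) (poisson_pmf b)"
  have "(\<lambda>(i, j). i + j) -` {n} = (\<lambda>i. (i, n - i)) ` {..n}"
    by (auto simp: image_iff)
  then have "pmf (map_pmf (\<lambda>(i, j). i + j) ?p) n = sum (pmf ?p) ((\<lambda>i. (i, n - i)) ` {..n})"
    by (simp add: pmf_map measure_measure_pmf_finite)
  also have "\<dots> = (\<Sum>i\<le>n. exp (- a - b) * (a ^ i / fact i * (b ^ (n - i) / fact (n - i))))"
    using assms by (subst sum.reindex) (auto simp: inj_on_def pmf_pair exp_diff exp_minus divide_inverse intro!: sum.cong)
  also have "\<dots> = exp (- a - b) * ((a + b) ^ n / fact n)"
    by (simp only: exp_series_binomial flip: sum_distrib_left)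
  also have "\<dots> = pmf (poisson_pmf (a + b)) n"
    using assms by simp
  finally show "pmf (map_pmf (\<lambda>(i, j). i + j) ?p) n = pmf (poisson_pmf (a + b)) n" .
qed

lemma has_bochner_integral_measure_pmf_nat:
  fixes f :: "nat \<Rightarrow> real"
  assumes "\<And>k. 0 \<le> f k" "(\<lambda>k. pmf p k * f k) sums S"
  shows "has_bochner_integral (measure_pmf p) f S"
proof -
  have "has_bochner_integral (count_space UNIV) (\<lambda>k. pmf p k * f k) S"
    using assms by (subst has_bochner_integral_iff)
      (auto simp: integrable_count_space_nat_iff integral_count_space_nat sums_iff abs_mult)
  then show ?thesis
    unfolding measure_pmf_eq_density by (intro has_bochner_integral_density) auto
qed

text \<open>The identity \<open>a (Suc k) * real (Suc k) = r * a k\<close> shifts each moment series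
  by one index and reduces it to the moment of one lower order.\<close>

lemma poisson_moments:
  assumes "0 < r"
  shows "has_bochner_integral (poisson_pmf r) (\<lambda>N. real N) r"
    and "has_bochner_integral (poisson_pmf r) (\<lambda>N. (real N)\<^sup>2) (r + r\<^sup>2)"
proof -
  define a where "a k = pmf (poisson_pmf r) k" for k
  have a_Suc: "a (Suc k) * real (Suc k) = r * a k" for k
    using assms by (simp add: a_def field_simps del: of_nat_Suc)
  have "(\<lambda>k. r ^ k / fact k * exp (- r)) sums (exp r * exp (- r))"
    using exp_converges[of r] by (intro sums_mult2) (simp add: divide_inverse mult.commute)
  then have a: "a sums 1"
    using assms by (simp add: a_def[abs_def] flip: exp_add)
  have 1: "(\<lambda>k. a k * real k) sums r"
    using sums_mult[OF a, of r] a_Suc by (subst sums_Suc_iff[symmetric, where f="\<lambda>k. a k * real k", simplified]) simp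
  have "(\<lambda>k. a (Suc k) * (real (Suc k))\<^sup>2) = (\<lambda>k. r * (a k + a k * real k))"
    using a_Suc by (auto simp: fun_eq_iff power2_eq_square mult.assoc[symmetric]) (simp add: algebra_simps)
  then have 2: "(\<lambda>k. a k * (real k)\<^sup>2) sums (r + r\<^sup>2)"
    using sums_mult[OF sums_add[OF a 1], of r]
    by (subst sums_Suc_iff[symmetric, where f="\<lambda>k. a k * (real k)\<^sup>2", simplified])
      (simp add: power2_eq_square distrib_left)
  show "has_bochner_integral (poisson_pmf r) (\<lambda>N. real N) r"
    "has_bochner_integral (poisson_pmf r) (\<lambda>N. (real N)\<^sup>2) (r + r\<^sup>2)"
    using 1 2 by (auto intro!: has_bochner_integral_measure_pmf_nat simp: a_def)
qed

section \<open>Quadratic comparison of a two-point variable with a Poisson variable\<close>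

definition poisson_pos_sq :: "real \<Rightarrow> real \<Rightarrow> real" where
  "poisson_pos_sq r y = measure_pmf.expectation (poisson_pmf r) (\<lambda>N. pos_sq (y + (real N - r)))"

lemma integrable_poisson_pos_sq:
  assumes "0 < r"
  shows "integrable (poisson_pmf r) (\<lambda>N. pos_sq (z + real N))"
proof (rule Bochner_Integration.integrable_bound)
  show "integrable (poisson_pmf r) (\<lambda>N. z\<^sup>2 + 2 * z * real N + (real N)\<^sup>2)"
    using poisson_moments[OF assms]
    by (intro Bochner_Integration.integrable_add integrable_mult_right) (auto simp: has_bochner_integral_iff)
  have "norm (pos_sq (z + real N)) \<le> norm (z\<^sup>2 + 2 * z * real N + (real N)\<^sup>2)" for N
    using pos_sq_le_square[of "z + real N"] pos_sq_nonneg[of "z + real N"]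
    by (simp add: power2_sum)
  then show "AE N in poisson_pmf r. norm (pos_sq (z + real N)) \<le> norm (z\<^sup>2 + 2 * z * real N + (real N)\<^sup>2)"
    by simp
qed simp

text \<open>If \<open>s \<le> y\<close>, both sides are the second moment
  \<open>y\<^sup>2 + s\<close>. If \<open>y < s\<close> and \<open>y + 1 \<ge> 0\<close>, the
  two-point value is exactly the Cauchy--Schwarz quotient of the square of
  \<open>E[N (y + N - s)] = s * (y + 1)\<close> by \<open>E[N\<^sup>2] = s * (1 + s)\<close>; for
  smaller \<open>y\<close> it is 0.\<close>

lemma two_point_op_le_poisson:
  assumes s: "0 < s"
  shows "two_point_op s pos_sq y \<le> poisson_pos_sq s y"
proof -
  note mom = poisson_moments[OF s, unfolded has_bochner_integral_iff]
  have quad: "measure_pmf.expectation (poisson_pmf s) (\<lambda>N. a + b * real N + c * (real N)\<^sup>2) = a + b * s + c * (s + s\<^sup>2)"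
    and int: "integrable (poisson_pmf s) (\<lambda>N. a + b * real N + c * (real N)\<^sup>2)" for a b c
    using mom by simp_all
  have pint: "integrable (poisson_pmf s) (\<lambda>N. pos_sq (y + (real N - s)))"
    using integrable_poisson_pos_sq[OF s, of "y - s"] by (simp add: algebra_simps)
  show ?thesis
  proof (cases "s \<le> y")
    case True
    have "pos_sq (y + (real N - s)) = (y - s)\<^sup>2 + 2 * (y - s) * real N + 1 * (real N)\<^sup>2" for N
      using True by (simp add: pos_sq_eq power2_eq_square algebra_simps)
    then have "poisson_pos_sq s y = (y - s)\<^sup>2 + 2 * (y - s) * s + 1 * (s + s\<^sup>2)"
      unfolding poisson_pos_sq_def by (simp only: quad)
    then show ?thesis
      using True s by (simp add: two_point_op_pos_sq power2_eq_square algebra_simps)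
  next
    case False
    define c where "c = max 0 (y + 1) / (1 + s)"
    have c: "0 \<le> c" using s by (simp add: c_def)
    \<comment> \<open>This minorant is the pointwise form of Cauchy--Schwarz for \<open>E[N (N - m)\<^sub>+]\<close> with \<open>m = s - y\<close>;
      \<open>c\<close> maximizes its expectation.\<close>
    have ptw: "0 + 2 * c * (y - s) * real N + (2 * c - c\<^sup>2) * (real N)\<^sup>2 \<le> pos_sq (y + (real N - s))" for N
    proof (cases "0 \<le> y + (real N - s)")
      case True
      have "0 \<le> (y + (real N - s) - c * real N)\<^sup>2" by simp
      then show ?thesis
        using True by (simp add: pos_sq_eq power2_eq_square algebra_simps)
    next
      case False
      have "c * real N * (y + (real N - s)) \<le> 0"
        using False c by (intro mult_nonneg_nonpos) auto
      moreover have "0 \<le> c\<^sup>2 * (real N)\<^sup>2" by simp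
      ultimately have "2 * (c * real N * (y + (real N - s))) - c\<^sup>2 * (real N)\<^sup>2 \<le> 0" by linarith
      then show ?thesis
        using False by (simp add: pos_sq_eq power2_eq_square algebra_simps)
    qed
    have "s * pos_sq (y + 1) / (1 + s) = 2 * c * (y - s) * s + (2 * c - c\<^sup>2) * (s + s\<^sup>2)"
    proof -
      have w: "max 0 (y + 1) = c * (1 + s)" using s by (simp add: c_def)
      have cy: "c * (y + 1) = c * (c * (1 + s))"
      proof (cases "y + 1 \<le> 0")
        case True then show ?thesis by (simp add: c_def)
      next
        case False then show ?thesis using w by simp
      qed
      have "2 * c * (y - s) * s + (2 * c - c\<^sup>2) * (s + s\<^sup>2) = s * (2 * (c * (y + 1)) - c\<^sup>2 * (1 + s))"
        by (simp add: power2_eq_square algebra_simps)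
      also have "\<dots> = s * (c\<^sup>2 * (1 + s))"
        unfolding cy by (simp add: power2_eq_square algebra_simps)
      finally show ?thesis
        using s w by (simp add: pos_sq_def power2_eq_square)
    qed
    also have "\<dots> = measure_pmf.expectation (poisson_pmf s)
        (\<lambda>N. 0 + 2 * c * (y - s) * real N + (2 * c - c\<^sup>2) * (real N)\<^sup>2)"
      unfolding quad by simp
    also have "\<dots> \<le> poisson_pos_sq s y"
      unfolding poisson_pos_sq_def by (intro integral_mono int pint ptw)
    finally show ?thesis
      using False s by (simp add: two_point_op_pos_sq)
  qed
qed

text \<open>Conditioning on one of two independent Poisson variables whose sum has rate
  \<open>a + b\<close>. The nonnegative integral permits the iterated form before its integrability
  is known.\<close>

lemma poisson_pos_sq_convolve:
  assumes "0 < a" "0 < b"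
  shows "(\<integral>\<^sup>+N. ennreal (poisson_pos_sq b (y + (real N - a))) \<partial>poisson_pmf a) =
    ennreal (poisson_pos_sq (a + b) y)"
proof -
  have nn: "ennreal (poisson_pos_sq r z) = (\<integral>\<^sup>+N. ennreal (pos_sq (z + (real N - r))) \<partial>poisson_pmf r)"
    if "0 < r" for r z
    unfolding poisson_pos_sq_def using integrable_poisson_pos_sq[OF that, of "z - r"]
    by (subst nn_integral_eq_integral) (auto simp: pos_sq_nonneg algebra_simps)
  show ?thesis
    using assms
    by (simp add: nn poisson_pmf_add[symmetric] nn_integral_pair_pmf' algebra_simps)
qed

text \<open>The first \<open>Suc m\<close> variables are replaced by a Poisson one by induction. The
  last operator is then exchanged with the Poisson expectation, compared pointwise inside it, and
  convolved. The exponent \<open>Suc m\<close> keeps the rate positive.\<close>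

lemma two_point_op_funpow_le_poisson:
  assumes s: "0 < s"
  shows "(two_point_op s ^^ Suc m) pos_sq y \<le> poisson_pos_sq (real (Suc m) * s) y"
proof (induction m arbitrary: y)
  case 0
  then show ?case using two_point_op_le_poisson[OF s] by simp
next
  case (Suc m)
  let ?a = "real (Suc m) * s"
  have a: "0 < ?a" using s by simp
  have int: "integrable (poisson_pmf ?a) (\<lambda>N. pos_sq (z + (real N - ?a)))" for z
    using integrable_poisson_pos_sq[OF a, of "z - ?a"] by (simp add: algebra_simps)
  have "(two_point_op s ^^ Suc (Suc m)) pos_sq y \<le> two_point_op s (poisson_pos_sq ?a) y"
    using s Suc.IH by (auto intro: two_point_op_mono)
  also have T: "two_point_op s (poisson_pos_sq ?a) y =
      measure_pmf.expectation (poisson_pmf ?a) (\<lambda>N. two_point_op s pos_sq (y + (real N - ?a)))"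
    using int[of "y - s"] int[of "y + 1"]
    unfolding poisson_pos_sq_def two_point_op_def by (simp add: algebra_simps)
  finally have le: "(two_point_op s ^^ Suc (Suc m)) pos_sq y \<le>
      measure_pmf.expectation (poisson_pmf ?a) (\<lambda>N. two_point_op s pos_sq (y + (real N - ?a)))" .
  have int2: "integrable (poisson_pmf ?a) (\<lambda>N. two_point_op s pos_sq (y + (real N - ?a)))"
    unfolding two_point_op_def using int[of "y - s"] int[of "y + 1"] by (simp add: algebra_simps)
  have "ennreal (measure_pmf.expectation (poisson_pmf ?a) (\<lambda>N. two_point_op s pos_sq (y + (real N - ?a)))) =
      (\<integral>\<^sup>+N. ennreal (two_point_op s pos_sq (y + (real N - ?a))) \<partial>poisson_pmf ?a)"
    using s by (intro nn_integral_eq_integral[symmetric] int2)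
      (auto simp: two_point_op_def intro!: divide_nonneg_pos add_nonneg_nonneg mult_nonneg_nonneg pos_sq_nonneg)
  also have "\<dots> \<le> (\<integral>\<^sup>+N. ennreal (poisson_pos_sq s (y + (real N - ?a))) \<partial>poisson_pmf ?a)"
    by (intro nn_integral_mono ennreal_leI two_point_op_le_poisson s)
  also have "\<dots> = ennreal (poisson_pos_sq (?a + s) y)"
    by (rule poisson_pos_sq_convolve[OF a s])
  finally have "measure_pmf.expectation (poisson_pmf ?a) (\<lambda>N. two_point_op s pos_sq (y + (real N - ?a))) \<le>
      poisson_pos_sq (?a + s) y"
    by (subst (asm) ennreal_le_iff) (auto simp: poisson_pos_sq_def intro!: integral_nonneg_AE pos_sq_nonneg)
  then show ?case using le by (simp add: algebra_simps)
qed

section \<open>Two-point sums and log-concave tails\<close>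

lemma (in prob_space) expectation_pos_sq_two_point_sum:
  assumes ind: "indep_vars (\<lambda>_. borel) G {1..n}" and s: "0 < s"
    and lo: "\<And>i. i \<in> {1..n} \<Longrightarrow> prob {\<omega> \<in> space M. G i \<omega> = - s} = 1 / (1 + s)"
    and hi: "\<And>i. i \<in> {1..n} \<Longrightarrow> prob {\<omega> \<in> space M. G i \<omega> = 1} = s / (1 + s)"
  shows "expectation (\<lambda>\<omega>. pos_sq (y + (\<Sum>i=1..n. G i \<omega>))) = (two_point_op s ^^ n) pos_sq y"
proof -
  have G_meas: "G i \<in> borel_measurable M" if "i \<in> {1..n}" for i
    using ind that by (auto simp: indep_vars_def)
  \<comment> \<open>The two prescribed probabilities add up to 1, so no other values occur almost
    surely.\<close>
  have G_AE: "AE \<omega> in M. G i \<omega> = - s \<or> G i \<omega> = 1" if i: "i \<in> {1..n}" for i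
  proof -
    note [measurable] = G_meas[OF i]
    have "{\<omega> \<in> space M. G i \<omega> = - s \<or> G i \<omega> = 1} =
        {\<omega> \<in> space M. G i \<omega> = - s} \<union> {\<omega> \<in> space M. G i \<omega> = 1}" by auto
    also have "prob \<dots> = 1 / (1 + s) + s / (1 + s)"
      using s by (subst finite_measure_Union) (auto simp: lo[OF i] hi[OF i])
    finally have "prob {\<omega> \<in> space M. G i \<omega> = - s \<or> G i \<omega> = 1} = 1"
      using s by (simp flip: add_divide_distrib)
    then show ?thesis by (subst (asm) prob_Collect_eq_1) measurable
  qed
  define S where "S m \<omega> = (\<Sum>i=1..m. G i \<omega>)" for m \<omega>
  have S_meas: "S m \<in> borel_measurable M" if "m \<le> n" for m
    unfolding S_def[abs_def] using that by (intro borel_measurable_sum G_meas) auto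
  have S_le: "AE \<omega> in M. S m \<omega> \<le> real m" if "m \<le> n" for m
    using that
  proof (induction m)
    case (Suc m)
    have "AE \<omega> in M. S m \<omega> \<le> real m" "AE \<omega> in M. G (Suc m) \<omega> = - s \<or> G (Suc m) \<omega> = 1"
      using Suc G_AE[of "Suc m"] by auto
    then show ?case by eventually_elim (use s in \<open>auto simp: S_def\<close>)
  qed (simp add: S_def)
  have int: "integrable M (\<lambda>\<omega>. pos_sq (y + S m \<omega>))" if "m \<le> n" for m y
  proof (rule integrable_const_bound[where B="pos_sq (y + m)"])
    show "AE \<omega> in M. norm (pos_sq (y + S m \<omega>)) \<le> pos_sq (y + m)"
      using S_le[OF that] by eventually_elim (auto simp: pos_sq_nonneg intro: pos_sq_mono)
  qed (use S_meas[OF that] in measurable)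
  have "expectation (\<lambda>\<omega>. pos_sq (y + S m \<omega>)) = (two_point_op s ^^ m) pos_sq y" if "m \<le> n" for m
    using that
  proof (induction m arbitrary: y)
    case 0
    then show ?case by (simp add: S_def prob_space)
  next
    case (Suc m)
    then have m: "m \<le> n" and i: "Suc m \<in> {1..n}" by auto
    note [measurable] = G_meas[OF i] S_meas[OF m]
    have iv: "indep_var borel (G (Suc m)) borel (S m)"
      unfolding S_def[abs_def]
      by (intro indep_vars_sum indep_vars_subset[OF ind]) (use Suc.prems in auto)
    \<comment> \<open>Splitting by the value \<open>a\<close> of the newest variable; independence
      from the earlier partial sum factors the expectation.\<close>
    define P where "P a z \<omega> = (indicator {a} (G (Suc m) \<omega>) :: real) * pos_sq (z + S m \<omega>)" for a z \<omega>
    have P: "integrable M (P a z) \<and> expectation (P a z) =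
        prob {\<omega> \<in> space M. G (Suc m) \<omega> = a} * (two_point_op s ^^ m) pos_sq z" for a z
    proof -
      have iv': "indep_var borel (\<lambda>\<omega>. indicator {a} (G (Suc m) \<omega>) :: real) borel (\<lambda>\<omega>. pos_sq (z + S m \<omega>))"
        using indep_var_compose[OF iv, of "indicator {a}" borel "\<lambda>u. pos_sq (z + u)" borel]
        by (simp add: comp_def)
      have ind_eq: "(\<lambda>\<omega>. indicator {a} (G (Suc m) \<omega>) :: real) \<in> borel_measurable M" by measurable
      have int': "integrable M (\<lambda>\<omega>. indicator {a} (G (Suc m) \<omega>) :: real)"
        by (rule integrable_const_bound[where B=1]) (auto simp: ind_eq)
      have "expectation (\<lambda>\<omega>. indicator {a} (G (Suc m) \<omega>) :: real) =
          expectation (indicator {\<omega> \<in> space M. G (Suc m) \<omega> = a})"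
        by (intro Bochner_Integration.integral_cong) (auto simp: indicator_def)
      also have "\<dots> = prob {\<omega> \<in> space M. G (Suc m) \<omega> = a}"
        by simp
      finally have "expectation (\<lambda>\<omega>. indicator {a} (G (Suc m) \<omega>) :: real) = prob {\<omega> \<in> space M. G (Suc m) \<omega> = a}" .
      then show ?thesis
        unfolding P_def
        using indep_var_integrable[OF iv' int' int[OF m]] indep_var_lebesgue_integral[OF iv' int' int[OF m]]
          Suc.IH[OF m, of z] by simp
    qed
    have "expectation (\<lambda>\<omega>. pos_sq (y + S (Suc m) \<omega>)) = expectation (\<lambda>\<omega>. P (- s) (y - s) \<omega> + P 1 (y + 1) \<omega>)"
    proof (rule integral_cong_AE)
      show "AE \<omega> in M. pos_sq (y + S (Suc m) \<omega>) = P (- s) (y - s) \<omega> + P 1 (y + 1) \<omega>"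
        using G_AE[OF i] by eventually_elim (use s in \<open>auto simp: P_def S_def algebra_simps\<close>)
    qed (use S_meas[OF Suc.prems] P in \<open>auto intro!: borel_measurable_add\<close>)
    also have "\<dots> = (two_point_op s ^^ Suc m) pos_sq y"
      using P lo[OF i] hi[OF i] by (simp add: two_point_op_def[of _ "(_ ^^ _) _"] add_divide_distrib)
    finally show ?case .
  qed
  from this[of n] show ?thesis by (simp add: S_def)
qed

section \<open>Exponential tails and log-concave majorants\<close>

lemma (in prob_space) nn_integral_pos_sq_exp_tail:
  assumes [measurable]: "Z \<in> borel_measurable M" and C: "0 \<le> C"
    and tail: "\<And>u. 0 \<le> u \<Longrightarrow> prob {\<omega> \<in> space M. u \<le> Z \<omega>} \<le> C * exp (- 2 * u)"
  shows "(\<integral>\<^sup>+\<omega>. ennreal (pos_sq (Z \<omega>)) \<partial>M) \<le> ennreal (C / 2)"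
proof -
  interpret P: pair_sigma_finite M lborel ..
  \<comment> \<open>Layer-cake formula: \<open>pos_sq z\<close> is the integral of
    \<open>2 * u\<close> over \<open>0 \<le> u \<le> z\<close>. Exchanging the integrals turns the
    expectation into an integral of tail probabilities.\<close>
  have layer: "ennreal (pos_sq z) = (\<integral>\<^sup>+u. ennreal (2 * u) * indicator {0..} u * indicator {u..} z \<partial>lborel)" for z
  proof -
    have "(\<integral>\<^sup>+u. ennreal (2 * u) * indicator {0..} u * indicator {u..} z \<partial>lborel) =
        (\<integral>\<^sup>+u. ennreal (2 * u) * indicator {0..max 0 z} u \<partial>lborel)"
    proof (rule nn_integral_cong_AE)
      show "AE u in lborel. ennreal (2 * u) * indicator {0..} u * indicator {u..} z = ennreal (2 * u) * indicator {0..max 0 z} u"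
        by (intro AE_I2) (auto simp: indicator_def max_def)
    qed
    also have "\<dots> = ennreal ((max 0 z)\<^sup>2 - 0\<^sup>2)"
      by (rule nn_integral_FTC_Icc[where F="\<lambda>u. u\<^sup>2"])
        (auto intro!: derivative_eq_intros simp: has_real_derivative_iff_has_vector_derivative[symmetric])
    finally show ?thesis by (simp add: pos_sq_def)
  qed
  have "(\<integral>\<^sup>+\<omega>. ennreal (pos_sq (Z \<omega>)) \<partial>M) =
      (\<integral>\<^sup>+\<omega>. \<integral>\<^sup>+u. ennreal (2 * u) * indicator {0..} u * indicator {u..} (Z \<omega>) \<partial>lborel \<partial>M)"
    by (simp add: layer)
  also have "\<dots> = (\<integral>\<^sup>+u. \<integral>\<^sup>+\<omega>. ennreal (2 * u) * indicator {0..} u * indicator {u..} (Z \<omega>) \<partial>M \<partial>lborel)"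
  proof (rule P.Fubini'[symmetric])
    have "(\<lambda>(\<omega>, u). ennreal (2 * u) * indicator {0..} u * (if u \<le> Z \<omega> then 1 else 0)) \<in> borel_measurable (M \<Otimes>\<^sub>M lborel)"
      by measurable
    then show "(\<lambda>(\<omega>, u). ennreal (2 * u) * indicator {0..} u * indicator {u..} (Z \<omega>)) \<in> borel_measurable (M \<Otimes>\<^sub>M lborel)"
      by (simp add: indicator_def)
  qed
  also have "\<dots> \<le> (\<integral>\<^sup>+u. ennreal (C * (2 * u * exp (- 2 * u))) * indicator {0..} u \<partial>lborel)"
  proof (rule nn_integral_mono)
    fix u :: real
    have "(\<integral>\<^sup>+\<omega>. ennreal (2 * u) * indicator {0..} u * indicator {u..} (Z \<omega>) \<partial>M) =
        ennreal (2 * u) * indicator {0..} u * (\<integral>\<^sup>+\<omega>. indicator {\<omega> \<in> space M. u \<le> Z \<omega>} \<omega> \<partial>M)"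
      by (subst nn_integral_cmult[symmetric]) (auto intro!: nn_integral_cong simp: indicator_def)
    also have "\<dots> = ennreal (2 * u) * indicator {0..} u * ennreal (prob {\<omega> \<in> space M. u \<le> Z \<omega>})"
      by (simp add: emeasure_eq_measure)
    also have "\<dots> \<le> ennreal (C * (2 * u * exp (- 2 * u))) * indicator {0..} u"
    proof (cases "0 \<le> u")
      case True
      have "2 * u * prob {\<omega> \<in> space M. u \<le> Z \<omega>} \<le> 2 * u * (C * exp (- 2 * u))"
        using True by (intro mult_left_mono tail) auto
      then show ?thesis
        using True by (simp add: ennreal_mult[symmetric] ac_simps ennreal_leI)
    qed simp
    finally show "(\<integral>\<^sup>+\<omega>. ennreal (2 * u) * indicator {0..} u * indicator {u..} (Z \<omega>) \<partial>M) \<le>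
        ennreal (C * (2 * u * exp (- 2 * u))) * indicator {0..} u" .
  qed
  also have "\<dots> = ennreal (0 - - (C / 2))"
  proof -
    \<comment> \<open>This function is an antiderivative of
      \<open>C * (2 * u * exp (- 2 * u))\<close>; its value \<open>- (C / 2)\<close> at 0 and limit
      0 give the integral \<open>C / 2\<close>.\<close>
    have "((\<lambda>u::real. - C * (u + 1 / 2) * exp (- 2 * u)) \<longlongrightarrow> 0) at_top"
    proof -
      have "((\<lambda>u::real. u ^ 1 / exp u) \<longlongrightarrow> 0) at_top" by (rule tendsto_power_div_exp_0)
      moreover have "((\<lambda>u::real. exp (- u)) \<longlongrightarrow> 0) at_top"
        by (intro filterlim_compose[OF exp_at_bot] filterlim_uminus_at_bot_at_top)
      ultimately have "((\<lambda>u::real. - C * ((u ^ 1 / exp u) * exp (- u) + 1 / 2 * (exp (- u) * exp (- u)))) \<longlongrightarrow>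
          - C * (0 * 0 + 1 / 2 * (0 * 0))) at_top"
        by (intro tendsto_intros)
      moreover have "(\<lambda>u. - C * ((u ^ 1 / exp u) * exp (- u) + 1 / 2 * (exp (- u) * exp (- u)))) =
          (\<lambda>u. - C * (u + 1 / 2) * exp (- 2 * u))"
      proof
        fix u :: real
        have "exp (- 2 * u) = exp (- u) * exp (- u)" by (simp flip: exp_add)
        moreover have "u ^ 1 / exp u = u * exp (- u)" by (simp add: exp_minus divide_inverse)
        ultimately show "- C * ((u ^ 1 / exp u) * exp (- u) + 1 / 2 * (exp (- u) * exp (- u))) =
          - C * (u + 1 / 2) * exp (- 2 * u)" by (simp only: distrib_right distrib_left mult.assoc)
      qed
      ultimately show ?thesis by (simp only: mult_zero_left mult_zero_right add_0)
    qed
    then show ?thesis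
      by (subst nn_integral_FTC_atLeast[where F="\<lambda>u. - C * (u + 1 / 2) * exp (- 2 * u)"])
        (auto intro!: derivative_eq_intros simp: C algebra_simps)
  qed
  finally show ?thesis by simp
qed

text \<open>Positivity makes \<open>- ln g\<close> a finite convex function on the whole line, so it
  has a supporting line at \<open>x\<close>; exponentiating gives the bound. The slope may have
  either sign.\<close>

lemma log_concave_exp_bound:
  assumes lc: "log_concave_fun g" and pos: "\<And>u. 0 < g u"
  obtains m where "\<And>u. g u \<le> g x * exp (- m * (u - x))"
proof -
  define \<phi> where "\<phi> u = - ln (g u)" for u
  have "convex_on UNIV \<phi>"
  proof (rule convex_onI)
    fix t u w :: real assume t: "0 < t" "t < 1"
    have "(1 - t) * ln (g u) + t * ln (g w) = ln (g u powr (1 - t) * g w powr t)"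
      using pos[of u] pos[of w] by (simp add: ln_mult ln_powr)
    also have "\<dots> \<le> ln (g ((1 - t) * u + t * w))"
    proof (subst ln_le_cancel_iff)
      show "0 < g u powr (1 - t) * g w powr t"
        using pos[of u] pos[of w] by simp
      show "g u powr (1 - t) * g w powr t \<le> g ((1 - t) * u + t * w)"
        using lc t by (simp add: log_concave_fun_def)
    qed (rule pos)
    finally show "\<phi> ((1 - t) *\<^sub>R u + t *\<^sub>R w) \<le> (1 - t) * \<phi> u + t * \<phi> w"
      by (simp add: \<phi>_def)
  qed simp
  then obtain m where m: "\<phi> x + m * (u - x) \<le> \<phi> u" for u
    using convex_le_Inf_differential[of UNIV \<phi> x] by auto
  have "g u \<le> g x * exp (- m * (u - x))" for u
  proof -
    have "ln (g u) \<le> ln (g x) - m * (u - x)" using m[of u] by (simp add: \<phi>_def)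
    then have "exp (ln (g u)) \<le> exp (ln (g x) - m * (u - x))" by simp
    then show ?thesis
      using pos[of u] pos[of x] by (simp add: exp_diff exp_minus divide_inverse)
  qed
  then show thesis by (rule that)
qed

text \<open>The rate \<open>m\<close> of the supporting exponential is taken as \<open>l\<close>. A
  negative rate is impossible, since \<open>g\<close> is at least 1 far to the left; for rate 0 the
  trivial value 1 suffices.\<close>

lemma (in prob_space) pos_sq_expectation_le_log_concave:
  assumes Y [measurable]: "Y \<in> borel_measurable M"
    and lc: "log_concave_fun g"
    and ge: "\<And>u. prob {\<omega> \<in> space M. u \<le> Y \<omega>} \<le> g u"
    and pos: "\<And>u. 0 < prob {\<omega> \<in> space M. u \<le> Y \<omega>}"
    and low: "AE \<omega> in M. b \<le> Y \<omega>"
  obtains l where "0 \<le> l" "expectation (\<lambda>\<omega>. pos_sq (1 + l / 2 * (Y \<omega> - x))) \<le> (exp 1)\<^sup>2 / 2 * g x"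
proof -
  have g_pos: "0 < g u" for u using pos[of u] ge[of u] by linarith
  obtain m where m: "\<And>u. g u \<le> g x * exp (- m * (u - x))"
    using log_concave_exp_bound[OF lc g_pos] by blast
  have one: "1 \<le> g u" if "u \<le> b" for u
  proof -
    have "prob {\<omega> \<in> space M. u \<le> Y \<omega>} = 1"
      using low that by (subst prob_Collect_eq_1) auto
    then show ?thesis using ge[of u] by simp
  qed
  consider "m < 0" | "m = 0" | "0 < m" by linarith
  then show thesis
  proof cases
    case 1
    \<comment> \<open>The point is far enough left for the exponential bound to drop below 1, while
      \<open>u \<le> b\<close> forces \<open>g u\<close> to be at least 1.\<close>
    define u where "u = min b (x - (\<bar>ln (g x)\<bar> + 1) / - m)"
    have "u - x \<le> - ((\<bar>ln (g x)\<bar> + 1) / - m)" by (simp add: u_def)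
    then have "- m * (u - x) \<le> - m * - ((\<bar>ln (g x)\<bar> + 1) / - m)"
      using 1 by (intro mult_left_mono) auto
    also have "\<dots> = - (\<bar>ln (g x)\<bar> + 1)" using 1 by simp
    finally have "ln (g x) - m * (u - x) < 0" by linarith
    then have "exp (ln (g x) - m * (u - x)) < 1" by simp
    then have "g x * exp (- m * (u - x)) < 1"
      using g_pos[of x] by (simp add: exp_diff exp_minus divide_inverse)
    moreover have "1 \<le> g u" by (rule one) (simp add: u_def)
    ultimately show thesis using m[of u] by linarith
  next
    case 2
    have "1 \<le> g x" using m[of b] one[of b] 2 by simp
    moreover have "2 \<le> (exp 1 :: real)\<^sup>2"
    proof -
      have "2 \<le> exp (1 :: real)" using exp_ge_add_one_self[of 1] by simp
      then have "2 * 1 \<le> exp (1::real) * exp 1" by (intro mult_mono) auto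
      then show ?thesis by (simp add: power2_eq_square)
    qed
    ultimately have "1 * 1 \<le> (exp 1 :: real)\<^sup>2 / 2 * g x" by (intro mult_mono) auto
    then show thesis
      using that[of 0] by (simp add: pos_sq_eq prob_space)
  next
    case 3
    \<comment> \<open>With this slope, \<open>u \<le> Z \<omega>\<close> means
      \<open>x + 2 * (u - 1) / m \<le> Y \<omega>\<close>, where the exponential is
      \<open>exp (2 - 2 * u)\<close>. The offset 1 produces the factor \<open>exp 2\<close>, and
      integrating against \<open>2 * u\<close> produces 1/2.\<close>
    define Z where "Z \<omega> = 1 + m / 2 * (Y \<omega> - x)" for \<omega>
    have [measurable]: "Z \<in> borel_measurable M" unfolding Z_def by measurable
    have "(\<integral>\<^sup>+\<omega>. ennreal (pos_sq (Z \<omega>)) \<partial>M) \<le> ennreal (g x * exp 2 / 2)"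
    proof (rule nn_integral_pos_sq_exp_tail)
      fix u :: real assume "0 \<le> u"
      have "(u \<le> Z \<omega>) = (x + 2 * (u - 1) / m \<le> Y \<omega>)" for \<omega>
        using 3 by (simp add: Z_def field_simps)
      then have "prob {\<omega> \<in> space M. u \<le> Z \<omega>} \<le> g (x + 2 * (u - 1) / m)"
        using ge by simp
      also have "\<dots> \<le> g x * exp (- m * (x + 2 * (u - 1) / m - x))" by (rule m)
      also have "- m * (x + 2 * (u - 1) / m - x) = 2 + - 2 * u"
        using 3 by (simp add: field_simps)
      also have "g x * exp (2 + - 2 * u) = g x * exp 2 * exp (- 2 * u)"
        by (simp only: exp_add mult.assoc)
      finally show "prob {\<omega> \<in> space M. u \<le> Z \<omega>} \<le> g x * exp 2 * exp (- 2 * u)" .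
    qed (use g_pos[of x] in auto)
    then have "enn2real (\<integral>\<^sup>+\<omega>. ennreal (pos_sq (Z \<omega>)) \<partial>M) \<le> g x * exp 2 / 2"
      using g_pos[of x] by (intro enn2real_leI) auto
    then have "expectation (\<lambda>\<omega>. pos_sq (Z \<omega>)) \<le> g x * exp 2 / 2"
      by (subst integral_eq_nn_integral) (auto simp: pos_sq_nonneg)
    then show thesis
      using that[of m] 3 by (simp add: Z_def exp_double[of 1, symmetric] mult.commute)
  qed
qed

section \<open>The quadratic tail bound\<close>

lemma (in prob_space) sets_tail_event:
  assumes "\<And>i. X i \<in> borel_measurable M"
  shows "tail_event M F X x v k \<in> sets M"
proof -
  note [measurable] = assms
  show ?thesis
    unfolding tail_event_def cond_second_moment_def by measurable
qed

lemma pos_sq_scale: "0 < l \<Longrightarrow> pos_sq (1 + l / 2 * (z - x)) = (l / 2)\<^sup>2 * pos_sq (2 / l - x + z)"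
proof -
  assume l: "0 < l"
  have "1 + l / 2 * (z - x) = l / 2 * (2 / l - x + z)"
    using l by (simp add: field_simps)
  also have "pos_sq \<dots> = (l / 2)\<^sup>2 * pos_sq (2 / l - x + z)"
    using l by (intro pos_sq_mult) simp
  finally show ?thesis .
qed

lemma quadratic_tail_bound_eq:
  "quadratic_tail_bound P Y x = (INF l\<in>{0..}. \<integral>\<omega>. pos_sq (1 + l / 2 * (Y \<omega> - x)) \<partial>P)"
  by (simp add: quadratic_tail_bound_def pos_sq_def)

lemma quadratic_tail_bound_le:
  assumes "0 \<le> l"
  shows "quadratic_tail_bound P Y x \<le> (\<integral>\<omega>. pos_sq (1 + l / 2 * (Y \<omega> - x)) \<partial>P)"
  unfolding quadratic_tail_bound_eq
  by (rule cINF_lower) (auto intro!: bdd_belowI[of _ 0] integral_nonneg_AE simp: pos_sq_nonneg assms)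

text \<open>For slope \<open>l = 0\<close> the expectation is 1, which is where
  \<open>p \<le> 1\<close> enters. Every positive slope reduces by homogeneity to the assumption at
  \<open>h = 2 / l\<close>.\<close>

lemma (in prob_space) le_quadratic_tail_bound:
  assumes "p \<le> 1" "\<And>h. 0 < h \<Longrightarrow> h\<^sup>2 * p \<le> expectation (\<lambda>\<omega>. pos_sq (h - x + Y \<omega>))"
  shows "p \<le> quadratic_tail_bound M Y x"
  unfolding quadratic_tail_bound_eq
proof (rule cINF_greatest)
  fix l :: real assume "l \<in> {0..}"
  then consider "l = 0" | "0 < l" by fastforce
  then show "p \<le> expectation (\<lambda>\<omega>. pos_sq (1 + l / 2 * (Y \<omega> - x)))"
  proof cases
    case 1
    then show ?thesis using assms(1) by (simp add: pos_sq_eq prob_space)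
  next
    case 2
    have "p = (l / 2)\<^sup>2 * ((2 / l)\<^sup>2 * p)"
      using 2 by (simp add: power2_eq_square)
    also have "\<dots> \<le> (l / 2)\<^sup>2 * expectation (\<lambda>\<omega>. pos_sq (2 / l - x + Y \<omega>))"
      using assms(2)[of "2 / l"] 2 by (intro mult_left_mono) auto
    also have "\<dots> = expectation (\<lambda>\<omega>. pos_sq (1 + l / 2 * (Y \<omega> - x)))"
      by (simp only: pos_sq_scale[OF 2] integral_mult_right_zero)
    finally show ?thesis .
  qed
qed auto

lemma quadratic_tail_bound_mono:
  assumes "prob_space P" "prob_space Q"
    and "\<And>y. (\<integral>\<omega>. pos_sq (y + Z \<omega>) \<partial>P) \<le> (\<integral>\<omega>. pos_sq (y + Y \<omega>) \<partial>Q)"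
  shows "quadratic_tail_bound P Z x \<le> quadratic_tail_bound Q Y x"
  unfolding quadratic_tail_bound_eq[of Q]
proof (rule cINF_greatest)
  fix l :: real assume l: "l \<in> {0..}"
  interpret P: prob_space P by fact
  interpret Q: prob_space Q by fact
  have "quadratic_tail_bound P Z x \<le> (\<integral>\<omega>. pos_sq (1 + l / 2 * (Z \<omega> - x)) \<partial>P)"
    using l by (intro quadratic_tail_bound_le) simp
  also have "\<dots> \<le> (\<integral>\<omega>. pos_sq (1 + l / 2 * (Y \<omega> - x)) \<partial>Q)"
  proof (cases "l = 0")
    case True
    then show ?thesis by (simp add: P.prob_space Q.prob_space)
  next
    case False
    then have "0 < l" using l by simp
    then show ?thesis
      using assms(3)[of "2 / l - x"]
      by (simp only: pos_sq_scale integral_mult_right_zero) (intro mult_left_mono; simp)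
  qed
  finally show "quadratic_tail_bound P Z x \<le> (\<integral>\<omega>. pos_sq (1 + l / 2 * (Y \<omega> - x)) \<partial>Q)" .
qed auto

theorem theorem2p1:
  fixes M :: "'a measure" and F :: "nat \<Rightarrow> 'a measure" and X :: "nat \<Rightarrow> 'a \<Rightarrow> real"
    and Q :: "'c measure" and Y :: "'c \<Rightarrow> real"
    and x v :: real
  assumes "prob_space M"
    and "supermartingale_difference M F X"
    and "AE \<omega> in M. X 0 \<omega> = 0"
    and "\<And>i. measure M {\<omega> \<in> space M. X i \<omega> \<le> 1} = 1"
    and "0 \<le> x" and "0 < v"
    and "prob_space Q" and "Y \<in> borel_measurable Q"
    and "distr Q borel Y =
           distr (measure_pmf (poisson_pmf (v\<^sup>2))) borel (\<lambda>N. real N - v\<^sup>2)"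
  shows "(\<forall>n\<ge>1. \<forall>(P :: 'b measure) G. prob_space P \<and> two_point_iid P n G (v\<^sup>2 / real n) \<longrightarrow>
            measure M (\<Union>k\<in>{1..n}. tail_event M F X x v k)
              \<le> quadratic_tail_bound P (\<lambda>\<omega>. \<Sum>i=1..n. G i \<omega>) x \<and>
            quadratic_tail_bound P (\<lambda>\<omega>. \<Sum>i=1..n. G i \<omega>) x
              \<le> quadratic_tail_bound Q Y x) \<and>
         measure M {\<omega> \<in> space M. \<exists>n\<ge>1. \<omega> \<in> tail_event M F X x v n}
           \<le> quadratic_tail_bound Q Y x \<and>
         quadratic_tail_bound Q Y x
           \<le> (exp 1)\<^sup>2 / 2 *
              log_concave_majorant (\<lambda>y. measure Q {\<omega> \<in> space Q. Y \<omega> \<ge> y}) x"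
proof -
  interpret M: prob_space M by fact
  interpret Q: prob_space Q by fact
  let ?\<Pi> = "poisson_pmf (v\<^sup>2)"
  have v2: "0 < v\<^sup>2" using \<open>0 < v\<close> by simp
  have [measurable]: "X i \<in> borel_measurable M" for i
    using assms(2) by (auto simp: supermartingale_difference_def)
  have X1: "AE \<omega> in M. X i \<omega> \<le> 1" for i
    using assms(4)[of i] by (subst (asm) M.prob_Collect_eq_1) measurable
  note [measurable] = \<open>Y \<in> borel_measurable Q\<close>
  have EY: "(\<integral>\<omega>. pos_sq (y + Y \<omega>) \<partial>Q) = poisson_pos_sq (v\<^sup>2) y" for y
  proof -
    have "(\<integral>\<omega>. pos_sq (y + Y \<omega>) \<partial>Q) = (\<integral>u. pos_sq (y + u) \<partial>distr Q borel Y)"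
      by (simp add: integral_distr)
    also have "\<dots> = poisson_pos_sq (v\<^sup>2) y"
      unfolding assms(9) poisson_pos_sq_def by (simp add: integral_distr)
    finally show ?thesis .
  qed
  have n2: "(two_point_op (v\<^sup>2 / real n) ^^ n) pos_sq y \<le> poisson_pos_sq (v\<^sup>2) y" if "1 \<le> n" for n y
    using two_point_op_funpow_le_poisson[of "v\<^sup>2 / real n" "n - 1" y] that v2 by simp
  let ?U = "\<lambda>n. \<Union>k\<in>{1..n}. tail_event M F X x v k"
  note union = M.tail_event_union_le[OF assms(2) X1]
  have 1: "measure M (?U n) \<le> quadratic_tail_bound P (\<lambda>\<omega>. \<Sum>i=1..n. G i \<omega>) x \<and>
      quadratic_tail_bound P (\<lambda>\<omega>. \<Sum>i=1..n. G i \<omega>) x \<le> quadratic_tail_bound Q Y x"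
    if n: "1 \<le> n" and P: "prob_space P" and G: "two_point_iid P n G (v\<^sup>2 / real n)" for n and P :: "'b measure" and G
  proof -
    interpret P: prob_space P by fact
    have "0 < v\<^sup>2 / real n" using v2 n by simp
    then have EG: "(\<integral>\<omega>. pos_sq (y + (\<Sum>i=1..n. G i \<omega>)) \<partial>P) = (two_point_op (v\<^sup>2 / real n) ^^ n) pos_sq y" for y
      using G unfolding two_point_iid_def by (intro P.expectation_pos_sq_two_point_sum) auto
    show ?thesis
    proof
      show "measure M (?U n) \<le> quadratic_tail_bound P (\<lambda>\<omega>. \<Sum>i=1..n. G i \<omega>) x"
        by (intro P.le_quadratic_tail_bound M.prob_le_1) (simp only: EG union)
      show "quadratic_tail_bound P (\<lambda>\<omega>. \<Sum>i=1..n. G i \<omega>) x \<le> quadratic_tail_bound Q Y x"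
        by (intro quadratic_tail_bound_mono P \<open>prob_space Q\<close>) (simp only: EG EY n2[OF n])
    qed
  qed
  \<comment> \<open>No space carrying the two-point variables is at hand here, so the operator
    powers are compared with the Poisson expectation directly.\<close>
  have U_le: "measure M (?U n) \<le> quadratic_tail_bound Q Y x" if "1 \<le> n" for n
    using union[where n=n] order_trans[OF _ n2[OF that]]
    by (intro Q.le_quadratic_tail_bound) (auto simp: EY)
  have 2: "measure M {\<omega> \<in> space M. \<exists>n\<ge>1. \<omega> \<in> tail_event M F X x v n} \<le> quadratic_tail_bound Q Y x"
  proof -
    \<comment> \<open>The unions increase with \<open>n\<close>, starting from the empty one at
      \<open>n = 0\<close>, so continuity from below extends the uniform bound to the infinite
      horizon.\<close>
    have "{\<omega> \<in> space M. \<exists>n\<ge>1. \<omega> \<in> tail_event M F X x v n} = (\<Union>n. ?U n)"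
      by (fastforce simp: tail_event_def)
    moreover have "(\<lambda>n. measure M (?U n)) \<longlonglongrightarrow> measure M (\<Union>n. ?U n)"
    proof (rule M.finite_Lim_measure_incseq)
      show "range ?U \<subseteq> sets M" by (auto intro!: M.sets_tail_event sets.finite_UN)
      show "incseq ?U" by (intro monoI UN_mono) auto
    qed
    ultimately show ?thesis
      using U_le by (auto intro: LIMSEQ_le_const2)
  qed
  have tail: "measure Q {\<omega> \<in> space Q. y \<le> Y \<omega>} = measure ?\<Pi> {N. y \<le> real N - v\<^sup>2}" for y
  proof -
    have "measure Q {\<omega> \<in> space Q. y \<le> Y \<omega>} = measure (distr Q borel Y) {y..}"
      by (subst measure_distr) (auto intro!: arg_cong[where f="measure Q"])
    also have "\<dots> = measure ?\<Pi> {N. y \<le> real N - v\<^sup>2}"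
      unfolding assms(9) by (subst measure_distr) (auto intro!: arg_cong[where f="measure ?\<Pi>"])
    finally show ?thesis .
  qed
  \<comment> \<open>A Poisson variable is unbounded, so every tail probability is positive and the
    logarithm of the majorant is finite.\<close>
  have pos: "0 < measure Q {\<omega> \<in> space Q. y \<le> Y \<omega>}" for y
  proof -
    obtain N :: nat where "y + v\<^sup>2 \<le> real N" using real_arch_simple by blast
    then show ?thesis
      unfolding tail by (intro measure_pmf_posI[of N]) (auto simp: set_pmf_poisson[OF v2])
  qed
  have low: "AE \<omega> in Q. - (v\<^sup>2) \<le> Y \<omega>"
    using tail[of "- (v\<^sup>2)"] by (simp add: Q.prob_Collect_eq_1)
  define g where "g = log_concave_majorant (\<lambda>y. measure Q {\<omega> \<in> space Q. Y \<omega> \<ge> y})"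
  \<comment> \<open>Tail probabilities lie between 0 and 1, which guarantees that the least
    log-concave majorant exists.\<close>
  have lc: "log_concave_fun g" and ge: "measure Q {\<omega> \<in> space Q. y \<le> Y \<omega>} \<le> g y" for y
    unfolding g_def
    using log_concave_majorant_least[of "\<lambda>y. measure Q {\<omega> \<in> space Q. Y \<omega> \<ge> y}" 1]
    by (auto simp: le_fun_def)
  obtain l where "0 \<le> l" "(\<integral>\<omega>. pos_sq (1 + l / 2 * (Y \<omega> - x)) \<partial>Q) \<le> (exp 1)\<^sup>2 / 2 * g x"
    using Q.pos_sq_expectation_le_log_concave[OF assms(8) lc ge pos low, of x] by blast
  then have 3: "quadratic_tail_bound Q Y x \<le> (exp 1)\<^sup>2 / 2 * g x"
    using quadratic_tail_bound_le[of l Q Y x] by linarith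
  show ?thesis
    using 1 2 3 unfolding g_def by blast
qed

end
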